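(* Let $k,\ell\in\mathbb{N}$, and let $V_1,V_2\in\widetilde{\mathcal{V}}_{k,\ell}$ be two indecomposable calibrated representations of $A$ of dimension $k+\ell$ with regular eigenvalues. Then $V_1\cong V_2$ as $A$-representations if and only if $V_1$ and $V_2$ are in the same $(N_k\times N_\ell)$-orbit. Thus $\mathcal{V}_{k,\ell}:=\widetilde{\mathcal{V}}_{k,\ell}/(N_k\times N_\ell)$ parametrizes the isomorphism classes of indecomposable $(k+\ell)$-dimensional calibrated $A$-representations with regular eigenvalues.
   Context: $A$ denotes the degenerate affine periplectic Brauer algebra on $2$ strands: the associative unital $\mathbb{C}$-algebra generated by $s,y_1,y_2,e$ with relations $$s^2=1,\quad y_1y_2=y_2y_1,\quad sy_1=y_2s-1-e,\quad sy_2=y_1s+1-e,$$ $$e^2=0,\quad es=e,\quad se=-e,\quad ey_2=ey_1+e,\quad y_1e=y_2e+e.$$ A representation of $A$ is called calibrated if it has a basis with respect to which $y_1$ and $y_2$ both act by diagonal matrices. A vector in $\mathbb{C}^{k+\ell}$ is written $(\underline{a},\underline{b})=(a_1,\dots,a_k,b_1,\dots,b_\ell)$, and $M_{k\times\ell}(\mathbb{C})$ is the set of $k\times\ell$ complex matrices. Regular eigenvalues: set $\mathbb{C}^{k+\ell,\mathrm{reg}}=\{(\underline{a},\underline{b})\in\mathbb{C}^{k+\ell}\mid a_i\neq a_j\text{ and } b_m\neq b_n\text{ for all }1\le i<j\le k,\ 1\le m<n\le\ell\}$. Suppose $V$ is a calibrated representation of $A$ such that $y_1-y_2$ acts on $V$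 by $\begin{pmatrix}\mathrm{Id}_k&0\\0&-\mathrm{Id}_\ell\end{pmatrix}$ in an eigenbasis for $y_1$ and $y_2$. If $y_1$ acts on $V$ by $\mathrm{diag}(\underline{a},\underline{b})$ for some $(\underline{a},\underline{b})\in\mathbb{C}^{k+\ell,\mathrm{reg}}$, then $V$ is said to have regular eigenvalues. Rhizomatic matrices: for $S=(s_{ij})\in M_{k\times\ell}(\mathbb{C})$, let $\sim$ be the equivalence relation on the (positions of) nonzero entries of $S$ generated by $s_{ij}\sim s_{mn}$ whenever $i=m$ or $j=n$. $S$ is rhizomatic if (i) $S$ has a single equivalence class of nonzero entries under $\sim$, and (ii) $S$ has a nonzero entry in every row and column. Set $\widetilde{\mathcal{V}}_{k,\ell}=\{(S,(\underline{a},\underline{b}))\mid S\in M_{k\times\ell}(\mathbb{C})\text{ is rhizomatic},\ (\underline{a},\underline{b})\in\mathbb{C}^{k+\ell,\mathrm{reg}}\}$. A pair $(S,(\underline{a},\underline{b}))\in\widetilde{\mathcal{V}}_{k,\ell}$ is identified with the calibrated representation $V_{k,\ell}(S;(\underline{a},\underline{b}))$ of $A$ on $\mathbb{C}^{k+\ell}$ given by $$y_1=\mathrm{diag}(a_1,\dots,a_k,b_1-1,\dots,b_\ell-1),\quad y_2=\mathrm{diag}(a_1-1,\dots,a_k-1,b_1,\dots,b_\ell),$$ $$s=\begin{pmatrix}-\mathrm{Id}_k&S\\0&\mathrm{Id}_\ell\end{pmatrix},\quad e=-sy_2+y_1s+\mathrm{Id}_{k+\ell}.$$ (Shifting all entries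 of $\underline{b}$ by $1$ does not affect membership in $\mathbb{C}^{k+\ell,\mathrm{reg}}$.) $N_k\subset\mathrm{GL}_k(\mathbb{C})$ is the group of $k\times k$ matrices with exactly one nonzero entry in every row and column; similarly $N_\ell\subset\mathrm{GL}_\ell(\mathbb{C})$. The group $N_k\times N_\ell$ acts on $\widetilde{\mathcal{V}}_{k,\ell}$ as follows: for $X_1=\sum_{i=1}^k\xi_i e_{i,\sigma(i)}\in N_k$ and $X_2=\sum_{j=1}^\ell\phi_j e_{j,\tau(j)}\in N_\ell$ (with $\xi_i,\phi_j\in\mathbb{C}^\times$, $\sigma\in S_k$, $\tau\in S_\ell$, and $e_{i,j}$ the matrix units), $$(X_1,X_2)\cdot(S,(\underline{a},\underline{b}))=\bigl(X_1SX_2^{-1},(a_{\sigma(1)},\dots,a_{\sigma(k)},b_{\tau(1)},\dots,b_{\tau(\ell)})\bigr).$$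
   Formalization: k and ℓ are taken positive. The parametrization of all isomorphism classes fails for k=ℓ=1, so there it is stated only after removing representations with e=0 whose +1-eigenspace of y1−y2 is not a subrepresentation. *)

theory Defs
  imports "HOL-Analysis.Analysis" "HOL-Library.Poly_Mapping"
begin

section \<open>The algebra by generators and relations\<close>

datatype pb_gen = GS | GY1 | GY2 | GE

text \<open>Words form the free monoid, so \<^typ>\<open>pb_gen list \<Rightarrow>\<^sub>0 complex\<close>, with the convolution
  product, is the free associative unital complex algebra on the four generators.\<close>

instantiation list :: (type) monoid_add
begin
definition "zero_list = ([] :: 'a list)"
definition "plus_list = ((@) :: 'a list \<Rightarrow> 'a list \<Rightarrow> 'a list)"
instance by standard (simp_all add: zero_list_def plus_list_def)
end

type_synonym free_alg = "pb_gen list \<Rightarrow>\<^sub>0 complex"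

definition free_gen :: "pb_gen \<Rightarrow> free_alg" where
  "free_gen g = Poly_Mapping.single [g] 1"

text \<open>A pair \<open>(l, r)\<close> stands for the relation \<open>l = r\<close>.\<close>

definition pb_relations :: "(free_alg \<times> free_alg) set" where
  "pb_relations =
    (let s = free_gen GS; y1 = free_gen GY1; y2 = free_gen GY2; e = free_gen GE in
     {(s * s, 1), (y1 * y2, y2 * y1),
      (s * y1, y2 * s - 1 - e), (s * y2, y1 * s + 1 - e),
      (e * e, 0), (e * s, e), (s * e, - e),
      (e * y2, e * y1 + e), (y1 * e, y2 * e + e)})"

text \<open>The two-sided ideal generated by the relations.\<close>

inductive_set pb_ideal :: "free_alg set" where
  zero: "0 \<in> pb_ideal"
| rel: "(l, r) \<in> pb_relations \<Longrightarrow> l - r \<in> pb_ideal"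
| add: "p \<in> pb_ideal \<Longrightarrow> q \<in> pb_ideal \<Longrightarrow> p + q \<in> pb_ideal"
| left: "p \<in> pb_ideal \<Longrightarrow> u * p \<in> pb_ideal"
| right: "p \<in> pb_ideal \<Longrightarrow> p * u \<in> pb_ideal"

lemma pb_ideal_uminus: "p \<in> pb_ideal \<Longrightarrow> - p \<in> pb_ideal"
  using pb_ideal.left[of p "- 1"] by simp

lemma pb_ideal_diff: "p \<in> pb_ideal \<Longrightarrow> q \<in> pb_ideal \<Longrightarrow> p - q \<in> pb_ideal"
  using pb_ideal.add[of p "- q"] pb_ideal_uminus by simp

subsection \<open>Evaluation of the free algebra at matrices\<close>

definition word_mat :: "(pb_gen \<Rightarrow> complex^'n^'n) \<Rightarrow> pb_gen list \<Rightarrow> complex^'n^'n" where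
  "word_mat M w = foldr (\<lambda>g X. M g ** X) w (mat 1)"

definition free_eval :: "(pb_gen \<Rightarrow> complex^'n^'n) \<Rightarrow> free_alg \<Rightarrow> complex^'n^'n" where
  "free_eval M p =
     (\<Sum>w\<in>Poly_Mapping.keys p. mat (Poly_Mapping.lookup p w) ** word_mat M w)"

lemma word_mat_append: "word_mat M (u + v) = word_mat M u ** word_mat M v"
  by (induction u) (simp_all add: word_mat_def plus_list_def matrix_mul_assoc)

lemma mat_mult_entry: "(mat c ** (A :: complex^'n^'n)) $ i $ j = c * A $ i $ j"
  by (simp add: mat_def matrix_matrix_mult_def if_distrib [where f = "\<lambda>x. x * _"] cong: if_cong)

lemma mult_mat_entry: "((A :: complex^'n^'n) ** mat c) $ i $ j = c * A $ i $ j"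
proof -
  have "(\<Sum>k\<in>UNIV. A $ i $ k * (if k = j then c else 0)) =
      (\<Sum>k\<in>UNIV. if k = j then c * A $ i $ k else 0)"
    by (rule sum.cong) auto
  then show ?thesis
    by (simp add: mat_def matrix_matrix_mult_def)
qed

lemma mat_commute: "mat c ** (A :: complex^'n^'n) = A ** mat c"
  by (simp add: vec_eq_iff mat_mult_entry mult_mat_entry)

lemma mat_zero: "mat 0 = (0 :: complex^'n^'n)"
  by (simp add: vec_eq_iff mat_def)

lemma mat_plus: "mat (c + d) = (mat c + mat d :: complex^'n^'n)"
  by (simp add: vec_eq_iff mat_def)

lemma mat_times: "mat (c * d) = (mat c ** mat d :: complex^'n^'n)"
  by (simp add: vec_eq_iff mat_mult_entry) (simp add: mat_def)

lemma matrix_distrib_right: "(A + B) ** C = A ** C + B ** (C :: complex^'p^'n)"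
  by (simp add: vec_eq_iff matrix_matrix_mult_def distrib_right sum.distrib)

lemma free_eval_superset:
  assumes "finite W" "Poly_Mapping.keys p \<subseteq> W"
  shows "free_eval M p = (\<Sum>w\<in>W. mat (Poly_Mapping.lookup p w) ** word_mat M w)"
  unfolding free_eval_def
  by (rule sum.mono_neutral_left) (use assms in \<open>auto simp: in_keys_iff mat_zero\<close>)

lemma free_eval_add: "free_eval M (p + q) = free_eval M p + free_eval M q"
proof -
  let ?W = "Poly_Mapping.keys p \<union> Poly_Mapping.keys q"
  have "free_eval M (p + q) =
      (\<Sum>w\<in>?W. mat (Poly_Mapping.lookup (p + q) w) ** word_mat M w)"
    by (rule free_eval_superset) (simp_all add: Poly_Mapping.keys_add)
  also have "\<dots> = (\<Sum>w\<in>?W. mat (Poly_Mapping.lookup p w) ** word_mat M w) +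
      (\<Sum>w\<in>?W. mat (Poly_Mapping.lookup q w) ** word_mat M w)"
    by (simp add: lookup_add mat_plus matrix_distrib_right sum.distrib)
  also have "\<dots> = free_eval M p + free_eval M q"
    by (simp add: free_eval_superset [where W = ?W])
  finally show ?thesis .
qed

lemma free_eval_zero [simp]: "free_eval M 0 = 0"
  by (simp add: free_eval_def)

lemma free_eval_single: "free_eval M (Poly_Mapping.single w c) = mat c ** word_mat M w"
  using free_eval_superset [of "{w}" "Poly_Mapping.single w c" M] by simp

lemma free_eval_one [simp]: "free_eval M 1 = mat 1"
  using free_eval_single [of M 0 1] by (simp add: word_mat_def) (simp add: zero_list_def)

lemma free_eval_gen [simp]: "free_eval M (free_gen g) = M g"
  by (simp add: free_gen_def free_eval_single word_mat_def)

lemma free_eval_uminus: "free_eval M (- p) = - free_eval M p"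
  using free_eval_add [of M p "- p"] by (simp add: eq_neg_iff_add_eq_0 add.commute)

lemma free_eval_diff: "free_eval M (p - q) = free_eval M p - free_eval M q"
  using free_eval_add [of M p "- q"] by (simp add: free_eval_uminus)

lemma free_alg_induct [case_names zero add]:
  fixes P :: "free_alg \<Rightarrow> bool"
  assumes "P 0" "\<And>w c q. P q \<Longrightarrow> P (Poly_Mapping.single w c + q)"
  shows "P p"
proof (induction p rule: update_induct)
  case const
  have "Poly_Mapping.single 0 0 = (0 :: free_alg)" by simp
  then show ?case using assms(1) by simp
next
  case (update f a b)
  have "Poly_Mapping.update a b f = Poly_Mapping.single a b + f"
    using update(1)
    by (intro poly_mapping_eqI)
       (auto simp: lookup_update lookup_add lookup_single in_keys_iff when_def)
  then show ?case using assms(2) update by simp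
qed

lemma free_eval_mult: "free_eval M (p * q) = free_eval M p ** free_eval M q"
proof (induction p rule: free_alg_induct)
  case (add u c p)
  have "free_eval M (Poly_Mapping.single u c * q) =
      free_eval M (Poly_Mapping.single u c) ** free_eval M q"
  proof (induction q rule: free_alg_induct)
    case (add v d q)
    have "mat (c * d) ** word_mat M (u + v) =
        mat c ** ((mat d ** word_mat M u) ** word_mat M v)"
      by (simp only: word_mat_append mat_times matrix_mul_assoc)
    also have "\<dots> = (mat c ** word_mat M u) ** (mat d ** word_mat M v)"
      by (simp only: mat_commute [of d "word_mat M u"] matrix_mul_assoc)
    finally have "free_eval M (Poly_Mapping.single u c * Poly_Mapping.single v d) =
        free_eval M (Poly_Mapping.single u c) ** free_eval M (Poly_Mapping.single v d)"
      by (simp only: mult_single free_eval_single)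
    with add show ?case
      by (simp add: distrib_left free_eval_add matrix_add_ldistrib)
  qed simp
  with add show ?case
    by (simp add: distrib_right free_eval_add matrix_distrib_right)
qed simp

definition satisfies_relations :: "(pb_gen \<Rightarrow> complex^'n^'n) \<Rightarrow> bool" where
  "satisfies_relations M \<longleftrightarrow> (\<forall>(l, r) \<in> pb_relations. free_eval M l = free_eval M r)"

lemma satisfies_relations_iff:
  "satisfies_relations M \<longleftrightarrow>
    (let s = M GS; y1 = M GY1; y2 = M GY2; e = M GE in
     s ** s = mat 1 \<and> y1 ** y2 = y2 ** y1 \<and>
     s ** y1 = y2 ** s - mat 1 - e \<and> s ** y2 = y1 ** s + mat 1 - e \<and>
     e ** e = 0 \<and> e ** s = e \<and> s ** e = - e \<and>
     e ** y2 = e ** y1 + e \<and> y1 ** e = y2 ** e + e)"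
  by (simp add: satisfies_relations_def pb_relations_def Let_def free_eval_add free_eval_diff
      free_eval_uminus free_eval_mult)

lemma free_eval_ideal:
  assumes "satisfies_relations M" "p \<in> pb_ideal"
  shows "free_eval M p = 0"
  using assms(2)
proof induction
  case (rel l r)
  then show ?case using assms(1)
    by (auto simp: satisfies_relations_def free_eval_diff)
qed (simp_all add: free_eval_add free_eval_mult)

lemma pb_ideal_proper: "1 \<notin> pb_ideal"
proof
  let ?M = "(\<lambda>g. case g of GS \<Rightarrow> - mat 1 | GY1 \<Rightarrow> 0 | GY2 \<Rightarrow> - mat 1 | GE \<Rightarrow> 0)
    :: pb_gen \<Rightarrow> complex^1^1"
  have "satisfies_relations ?M"
    by (simp add: satisfies_relations_iff vec_eq_iff matrix_matrix_mult_def mat_def)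
  moreover assume "1 \<in> pb_ideal"
  ultimately have "free_eval ?M 1 = 0"
    by (rule free_eval_ideal)
  then show False
    by (simp add: vec_eq_iff mat_def)
qed

subsection \<open>The quotient algebra\<close>

quotient_type pb_alg = free_alg / "\<lambda>p q. p - q \<in> pb_ideal"
proof (rule equivpI)
  show "reflp (\<lambda>p q. p - q \<in> pb_ideal)"
    by (rule reflpI) (simp add: pb_ideal.zero)
  show "symp (\<lambda>p q. p - q \<in> pb_ideal)"
    proof (rule sympI)
    fix p q :: free_alg
    assume "p - q \<in> pb_ideal"
    from pb_ideal_uminus[OF this] show "q - p \<in> pb_ideal" by simp
  qed
  show "transp (\<lambda>p q. p - q \<in> pb_ideal)"
  proof (rule transpI)
    fix p q r :: free_alg
    assume "p - q \<in> pb_ideal" "q - r \<in> pb_ideal"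
    from pb_ideal.add[OF this] show "p - r \<in> pb_ideal" by simp
  qed
qed

instantiation pb_alg :: ring_1
begin

lift_definition zero_pb_alg :: pb_alg is 0 .
lift_definition one_pb_alg :: pb_alg is 1 .

lift_definition plus_pb_alg :: "pb_alg \<Rightarrow> pb_alg \<Rightarrow> pb_alg" is "(+)"
proof -
  fix p p' q q' :: free_alg
  assume "p - p' \<in> pb_ideal" "q - q' \<in> pb_ideal"
  from pb_ideal.add[OF this] show "(p + q) - (p' + q') \<in> pb_ideal"
    by (simp add: algebra_simps)
qed

lift_definition uminus_pb_alg :: "pb_alg \<Rightarrow> pb_alg" is uminus
proof -
  fix p p' :: free_alg
  assume "p - p' \<in> pb_ideal"
  from pb_ideal_uminus[OF this] show "- p - - p' \<in> pb_ideal" by simp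
qed

lift_definition minus_pb_alg :: "pb_alg \<Rightarrow> pb_alg \<Rightarrow> pb_alg" is "(-)"
proof -
  fix p p' q q' :: free_alg
  assume "p - p' \<in> pb_ideal" "q - q' \<in> pb_ideal"
  from pb_ideal_diff[OF this] show "(p - q) - (p' - q') \<in> pb_ideal"
    by (simp add: algebra_simps)
qed

lift_definition times_pb_alg :: "pb_alg \<Rightarrow> pb_alg \<Rightarrow> pb_alg" is "(*)"
proof -
  fix p p' q q' :: free_alg
  assume "p - p' \<in> pb_ideal" "q - q' \<in> pb_ideal"
  then have "(p - p') * q + p' * (q - q') \<in> pb_ideal"
    by (intro pb_ideal.add pb_ideal.left pb_ideal.right)
  then show "p * q - p' * q' \<in> pb_ideal"
    by (simp add: algebra_simps)
qed

instance
proof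
  have refl: "p - q \<in> pb_ideal" if "p = q" for p q
    using that by (simp add: pb_ideal.zero)
  fix a b c :: pb_alg
  show "a + b + c = a + (b + c)" by transfer (rule refl, simp add: algebra_simps)
  show "a + b = b + a" by transfer (rule refl, simp add: algebra_simps)
  show "0 + a = a" by transfer (rule refl, simp)
  show "- a + a = 0" by transfer (rule refl, simp)
  show "a - b = a + - b" by transfer (rule refl, simp)
  show "a * b * c = a * (b * c)" by transfer (rule refl, simp add: algebra_simps)
  show "(a + b) * c = a * c + b * c" by transfer (rule refl, simp add: algebra_simps)
  show "a * (b + c) = a * b + a * c" by transfer (rule refl, simp add: algebra_simps)
  show "1 * a = a" by transfer (rule refl, simp)
  show "a * 1 = a" by transfer (rule refl, simp)
  show "(0 :: pb_alg) \<noteq> 1" by transfer (use pb_ideal_uminus [of "0 - 1"] pb_ideal_proper in auto)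
qed

end

text \<open>The structure map of the complex algebra; scalar multiplication is \<open>pb_const c * x\<close>.\<close>

lift_definition pb_const :: "complex \<Rightarrow> pb_alg" is "Poly_Mapping.single 0" .

lift_definition pb_of :: "pb_gen \<Rightarrow> pb_alg" is free_gen .

abbreviation "pb_s \<equiv> pb_of GS"
abbreviation "pb_y1 \<equiv> pb_of GY1"
abbreviation "pb_y2 \<equiv> pb_of GY2"
abbreviation "pb_e \<equiv> pb_of GE"

section \<open>Representations\<close>

text \<open>Representations on \<open>\<complex>\<^sup>n\<close> as algebra homomorphisms into square matrices. The condition on
  \<^const>\<open>pb_const\<close> gives both complex linearity and \<open>\<rho> 1 = mat 1\<close>.\<close>

type_synonym 'n pb_rep = "pb_alg \<Rightarrow> complex^'n^'n"

definition is_rep :: "('n::finite) pb_rep \<Rightarrow> bool" where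
  "is_rep \<rho> \<longleftrightarrow>
     (\<forall>x y. \<rho> (x + y) = \<rho> x + \<rho> y) \<and>
     (\<forall>x y. \<rho> (x * y) = \<rho> x ** \<rho> y) \<and>
     (\<forall>c. \<rho> (pb_const c) = mat c)"

definition rep_iso :: "('n::finite) pb_rep \<Rightarrow> 'n pb_rep \<Rightarrow> bool" where
  "rep_iso \<rho> \<rho>' \<longleftrightarrow> (\<exists>P. invertible P \<and> (\<forall>x. P ** \<rho> x = \<rho>' x ** P))"

definition subrep :: "('n::finite) pb_rep \<Rightarrow> (complex^'n) set \<Rightarrow> bool" where
  "subrep \<rho> U \<longleftrightarrow> vec.subspace U \<and> (\<forall>x. \<forall>v\<in>U. \<rho> x *v v \<in> U)"

text \<open>The representation space is nonzero because index types are nonempty.\<close>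

definition indecomposable :: "('n::finite) pb_rep \<Rightarrow> bool" where
  "indecomposable \<rho> \<longleftrightarrow>
     \<not> (\<exists>U W. subrep \<rho> U \<and> subrep \<rho> W \<and> U \<noteq> {0} \<and> W \<noteq> {0} \<and>
          U \<inter> W = {0} \<and> {u + w | u w. u \<in> U \<and> w \<in> W} = UNIV)"

definition diag :: "complex^'n \<Rightarrow> complex^'n^'n" where
  "diag v = (\<chi> i j. if i = j then v $ i else 0)"

text \<open>\<open>acts_as \<rho> P x D\<close>: in the basis formed by the columns of \<open>P\<close>, \<open>x\<close> acts by \<open>D\<close>.\<close>

definition acts_as ::
  "('n::finite) pb_rep \<Rightarrow> complex^'n^'n \<Rightarrow> pb_alg \<Rightarrow> complex^'n^'n \<Rightarrow> bool" where
  "acts_as \<rho> P x D \<longleftrightarrow> matrix_inv P ** \<rho> x ** P = D"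

definition eigenbasis :: "('n::finite) pb_rep \<Rightarrow> complex^'n^'n \<Rightarrow> bool" where
  "eigenbasis \<rho> P \<longleftrightarrow>
     invertible P \<and> (\<exists>u. acts_as \<rho> P pb_y1 (diag u)) \<and> (\<exists>v. acts_as \<rho> P pb_y2 (diag v))"

definition calibrated :: "('n::finite) pb_rep \<Rightarrow> bool" where
  "calibrated \<rho> \<longleftrightarrow> (\<exists>P. eigenbasis \<rho> P)"

section \<open>Regular eigenvalues\<close>

text \<open>The dimensions \<open>k, \<ell> \<ge> 1\<close> are the cardinalities of the index types \<^typ>\<open>'k\<close> and
  \<^typ>\<open>'l\<close>; \<open>\<complex>\<^sup>k\<^sup>+\<^sup>\<ell>\<close> is indexed by their sum type.\<close>

definition vjoin :: "complex^'k \<Rightarrow> complex^'l \<Rightarrow> complex^('k + 'l)" where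
  "vjoin a b = (\<chi> i. case i of Inl i \<Rightarrow> a $ i | Inr j \<Rightarrow> b $ j)"

definition block :: "complex^'k^'k \<Rightarrow> complex^'l^'k \<Rightarrow> complex^'k^'l \<Rightarrow> complex^'l^'l
    \<Rightarrow> complex^('k + 'l)^('k + 'l)" where
  "block A B C D = (\<chi> i j. case (i, j) of
     (Inl i, Inl j) \<Rightarrow> A $ i $ j | (Inl i, Inr j) \<Rightarrow> B $ i $ j
   | (Inr i, Inl j) \<Rightarrow> C $ i $ j | (Inr i, Inr j) \<Rightarrow> D $ i $ j)"

definition reg :: "((complex^'k) \<times> (complex^'l)) set" where
  "reg = {(a, b). (\<forall>i j. i \<noteq> j \<longrightarrow> a $ i \<noteq> a $ j) \<and> (\<forall>m n. m \<noteq> n \<longrightarrow> b $ m \<noteq> b $ n)}"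

definition regular_eigenvalues :: "('k::finite + 'l::finite) pb_rep \<Rightarrow> bool" where
  "regular_eigenvalues \<rho> \<longleftrightarrow>
     (\<exists>P. eigenbasis \<rho> P \<and>
          acts_as \<rho> P (pb_y1 - pb_y2) (block (mat 1) 0 0 (- mat 1)) \<and>
          (\<exists>(a :: complex^'k, b :: complex^'l) \<in> reg. acts_as \<rho> P pb_y1 (diag (vjoin a b))))"

definition regular_indecomposables :: "('k::finite + 'l::finite) pb_rep set" where
  "regular_indecomposables =
     {\<rho>. is_rep \<rho> \<and> calibrated \<rho> \<and> regular_eigenvalues \<rho> \<and> indecomposable \<rho>}"

definition iso_rel :: "(('k::finite + 'l::finite) pb_rep \<times> ('k::finite + 'l::finite) pb_rep) set" where
  "iso_rel = {(\<rho>, \<rho>'). \<rho> \<in> regular_indecomposables \<and> \<rho>' \<in> regular_indecomposables \<and>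
                       rep_iso \<rho> \<rho>'}"

section \<open>Rhizomatic matrices\<close>

definition nonzero_pos :: "complex^'l^'k \<Rightarrow> ('k \<times> 'l) set" where
  "nonzero_pos S = {(i, j). S $ i $ j \<noteq> 0}"

definition linked :: "complex^'l^'k \<Rightarrow> 'k \<times> 'l \<Rightarrow> 'k \<times> 'l \<Rightarrow> bool" where
  "linked S p q \<longleftrightarrow>
     p \<in> nonzero_pos S \<and> q \<in> nonzero_pos S \<and> (fst p = fst q \<or> snd p = snd q)"

definition rhizo_equiv :: "complex^'l^'k \<Rightarrow> (('k \<times> 'l) \<times> ('k \<times> 'l)) set" where
  "rhizo_equiv S =
     {(p, q). p \<in> nonzero_pos S \<and> q \<in> nonzero_pos S \<and> equivclp (linked S) p q}"

definition rhizomatic :: "complex^'l^'k \<Rightarrow> bool" where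
  "rhizomatic S \<longleftrightarrow>
     card (nonzero_pos S // rhizo_equiv S) = 1 \<and>
     (\<forall>i. \<exists>j. S $ i $ j \<noteq> 0) \<and> (\<forall>j. \<exists>i. S $ i $ j \<noteq> 0)"

type_synonym ('k, 'l) datum = "(complex^'l^'k) \<times> (complex^'k) \<times> (complex^'l)"

definition V_tilde :: "('k::finite, 'l::finite) datum set" where
  "V_tilde = {(S, ab). rhizomatic S \<and> ab \<in> reg}"

definition V_gen :: "('k::finite, 'l::finite) datum \<Rightarrow> pb_gen \<Rightarrow> complex^('k + 'l)^('k + 'l)" where
  "V_gen = (\<lambda>(S, (a, b)).
     let y1 = diag (vjoin a (\<chi> j. b $ j - 1));
         y2 = diag (vjoin (\<chi> i. a $ i - 1) b);
         s = block (- mat 1) S 0 (mat 1);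
         e = - (s ** y2) + y1 ** s + mat 1
     in (\<lambda>g. case g of GS \<Rightarrow> s | GY1 \<Rightarrow> y1 | GY2 \<Rightarrow> y2 | GE \<Rightarrow> e))"

definition V_rep :: "('k::finite, 'l::finite) datum \<Rightarrow> ('k + 'l) pb_rep" where
  "V_rep d = (THE \<rho>. is_rep \<rho> \<and> (\<forall>g. \<rho> (pb_of g) = V_gen d g))"

subsection \<open>The representation is well defined\<close>

lemma is_rep_extend:
  assumes "satisfies_relations M"
  shows "\<exists>!\<rho>. is_rep \<rho> \<and> (\<forall>g. \<rho> (pb_of g) = M g)"
proof (rule ex_ex1I)
  have wd: "free_eval M p = free_eval M q" if "p - q \<in> pb_ideal" for p q
    using free_eval_ideal [OF assms that] by (simp add: free_eval_diff)
  define \<rho> where "\<rho> x = free_eval M (rep_pb_alg x)" for x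
  have abs: "\<rho> (abs_pb_alg p) = free_eval M p" for p
    unfolding \<rho>_def
    by (rule wd) (use Quotient3_rep_abs [OF Quotient3_pb_alg, of p] in \<open>simp add: pb_ideal.zero\<close>)
  have "is_rep \<rho>"
    unfolding is_rep_def
  proof (intro conjI allI)
    fix x y c
    obtain p q where pq: "x = abs_pb_alg p" "y = abs_pb_alg q"
      using Quotient3_abs_rep [OF Quotient3_pb_alg] by metis
    show "\<rho> (x + y) = \<rho> x + \<rho> y"
      by (simp add: pq plus_pb_alg.abs_eq abs free_eval_add)
    show "\<rho> (x * y) = \<rho> x ** \<rho> y"
      by (simp add: pq times_pb_alg.abs_eq abs free_eval_mult)
    show "\<rho> (pb_const c) = mat c"
      by (simp add: pb_const.abs_eq abs free_eval_single word_mat_def zero_list_def)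
  qed
  moreover have "\<rho> (pb_of g) = M g" for g
    by (simp add: pb_of.abs_eq abs)
  ultimately show "\<exists>\<rho>. is_rep \<rho> \<and> (\<forall>g. \<rho> (pb_of g) = M g)" by blast
next
  fix \<rho> \<rho>'
  assume r: "is_rep \<rho> \<and> (\<forall>g. \<rho> (pb_of g) = M g)" and r': "is_rep \<rho>' \<and> (\<forall>g. \<rho>' (pb_of g) = M g)"
  have single: "abs_pb_alg (Poly_Mapping.single w c) =
      pb_const c * abs_pb_alg (Poly_Mapping.single w 1)" for w c
    by (simp add: pb_const.abs_eq times_pb_alg.abs_eq mult_single)
  have cons: "abs_pb_alg (Poly_Mapping.single (g # w) 1) =
      pb_of g * abs_pb_alg (Poly_Mapping.single w 1)" for g w
    by (simp add: pb_of.abs_eq times_pb_alg.abs_eq free_gen_def mult_single plus_list_def)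
  have nil: "abs_pb_alg (Poly_Mapping.single [] 1) = pb_const 1"
    by (simp add: pb_const.abs_eq flip: zero_list_def)
  have word: "\<rho> (abs_pb_alg (Poly_Mapping.single w 1)) = \<rho>' (abs_pb_alg (Poly_Mapping.single w 1))"
    for w
    using r r' by (induction w) (auto simp: is_rep_def nil cons)
  have abs_zero: "abs_pb_alg 0 = pb_const 0"
    by (simp add: pb_const.abs_eq)
  have "\<rho> (abs_pb_alg p) = \<rho>' (abs_pb_alg p)" for p
  proof (induction p rule: free_alg_induct)
    case zero
    then show ?case using r r' by (simp add: is_rep_def abs_zero)
  next
    case (add w c q)
    have "\<rho> (abs_pb_alg (Poly_Mapping.single w c)) = \<rho>' (abs_pb_alg (Poly_Mapping.single w c))"
      using r r' word by (simp add: single [of w c] is_rep_def)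
    then show ?case
      using add r r' by (simp add: is_rep_def plus_pb_alg.abs_eq [symmetric])
  qed
  then have "\<rho> (abs_pb_alg (rep_pb_alg x)) = \<rho>' (abs_pb_alg (rep_pb_alg x))" for x
    by simp
  then show "\<rho> = \<rho>'"
    by (simp add: Quotient3_abs_rep [OF Quotient3_pb_alg] fun_eq_iff)
qed

lemma sum_UNIV_Plus:
  "(\<Sum>x\<in>(UNIV :: ('k::finite + 'l::finite) set). f x) =
     (\<Sum>i\<in>UNIV. f (Inl i)) + (\<Sum>j\<in>UNIV. f (Inr j))"
  by (subst UNIV_Plus_UNIV [symmetric], subst sum.Plus) simp_all

lemma block_mult:
  "block A B C D ** block A' B' C' D' =
   block (A ** A' + B ** C') (A ** B' + B ** D') (C ** A' + D ** C') (C ** B' + D ** D')"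
  unfolding block_def matrix_matrix_mult_def vec_eq_iff
  by (auto simp: sum_UNIV_Plus split: sum.splits)

lemma block_add: "block A B C D + block A' B' C' D' = block (A + A') (B + B') (C + C') (D + D')"
  by (auto simp: block_def vec_eq_iff split: sum.splits)

lemma block_diff: "block A B C D - block A' B' C' D' = block (A - A') (B - B') (C - C') (D - D')"
  by (auto simp: block_def vec_eq_iff split: sum.splits)

lemma block_uminus: "- block A B C D = block (- A) (- B) (- C) (- D)"
  by (auto simp: block_def vec_eq_iff split: sum.splits)

lemma block_zero: "block 0 0 0 0 = 0"
  by (auto simp: block_def vec_eq_iff split: sum.splits)

lemma mat_block: "(mat c :: complex^('k::finite + 'l::finite)^('k + 'l)) = block (mat c) 0 0 (mat c)"
  by (auto simp: block_def mat_def vec_eq_iff split: sum.splits)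

lemma diag_block: "diag (vjoin a b) = block (diag a) 0 0 (diag b)"
  by (auto simp: block_def diag_def vjoin_def vec_eq_iff split: sum.splits)

lemma diag_mult_entry: "(diag v ** A) $ i $ j = v $ i * A $ i $ j"
  by (simp add: diag_def matrix_matrix_mult_def if_distrib [where f = "\<lambda>x. x * _"] cong: if_cong)

lemma mult_diag_entry: "(A ** diag v) $ i $ j = A $ i $ j * v $ j"
  by (simp add: diag_def matrix_matrix_mult_def if_distrib [where f = "\<lambda>x. _ * x"] cong: if_cong)

lemma V_gen_satisfies:
  fixes d :: "('k::finite, 'l::finite) datum"
  shows "satisfies_relations (V_gen d)"
proof -
  obtain S a b where d: "d = (S, (a, b))" by (cases d) auto
  have neg: "- A ** B = - (A ** B)" "A ** (- B) = - (A ** B)"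
    for A :: "complex^'m^'n" and B :: "complex^'p^'m"
    by (simp_all add: matrix_matrix_mult_def vec_eq_iff sum_negf)
  define E where "E = diag a ** S - S ** diag b"
  let ?b' = "\<chi> j. b $ j - 1" and ?a' = "\<chi> i. a $ i - 1"
  have b': "diag ?b' = diag b - mat 1" and a': "diag ?a' = diag a - mat 1"
    by (auto simp: diag_def mat_def vec_eq_iff)
  have dl: "(A - A') ** B = A ** B - A' ** B"
    for A A' :: "complex^'m^'n" and B :: "complex^'p^'m"
    by (simp add: matrix_matrix_mult_def vec_eq_iff left_diff_distrib sum_subtractf)
  have dr: "B ** (A - A') = B ** A - B ** A'"
    for A A' :: "complex^'m^'n" and B :: "complex^'n^'p"
    by (simp add: matrix_matrix_mult_def vec_eq_iff right_diff_distrib sum_subtractf)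
  have e: "V_gen d GE = block 0 E 0 0"
    unfolding V_gen_def d Let_def
    by (simp add: mat_block [where 'k = 'k and 'l = 'l] diag_block block_mult
        block_add block_uminus neg a' b' E_def)
  have s: "V_gen d GS = block (- mat 1) S 0 (mat 1)"
    and y1: "V_gen d GY1 = block (diag a) 0 0 (diag b - mat 1)"
    and y2: "V_gen d GY2 = block (diag a - mat 1) 0 0 (diag b)"
    by (simp_all add: V_gen_def d Let_def diag_block a' b')
  note simps = block_mult block_add block_diff block_uminus neg dl dr
  note mb = mat_block [where 'k = 'k and 'l = 'l] block_zero [symmetric]
  let ?s = "block (- mat 1) S 0 (mat 1)" and ?e = "block 0 E 0 0"
    and ?y1 = "block (diag a) 0 0 (diag b - mat 1)" and ?y2 = "block (diag a - mat 1) 0 0 (diag b)"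
  have "?s ** ?s = mat 1" "?y1 ** ?y2 = ?y2 ** ?y1"
    unfolding mb by (simp_all add: simps)
  moreover have "?s ** ?y1 = ?y2 ** ?s - mat 1 - ?e" "?s ** ?y2 = ?y1 ** ?s + mat 1 - ?e"
    unfolding mb by (simp_all add: simps E_def)
  moreover have "?e ** ?e = 0" "?e ** ?s = ?e" "?s ** ?e = - ?e"
    unfolding mb by (simp_all add: simps)
  moreover have "?e ** ?y2 = ?e ** ?y1 + ?e" "?y1 ** ?e = ?y2 ** ?e + ?e"
    by (simp_all add: simps)
  ultimately show ?thesis
    unfolding satisfies_relations_iff Let_def e s y1 y2 by (intro conjI)
qed

lemma V_rep_unique_existence: "\<exists>!\<rho>. is_rep \<rho> \<and> (\<forall>g. \<rho> (pb_of g) = V_gen d g)"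
  by (rule is_rep_extend [OF V_gen_satisfies])

section \<open>The group action\<close>

definition monomial_mats :: "(complex^'n^'n) set" where
  "monomial_mats =
     {X. (\<forall>i. \<exists>!j. X $ i $ j \<noteq> 0) \<and> (\<forall>j. \<exists>!i. X $ i $ j \<noteq> 0)}"

text \<open>The permutation \<open>\<sigma>\<close> with \<open>X = \<Sum>\<^sub>i \<xi>\<^sub>i e\<^sub>i\<^sub>,\<^sub>\<sigma>\<^sub>(\<^sub>i\<^sub>)\<close>.\<close>

definition mono_perm :: "complex^'n^'n \<Rightarrow> 'n \<Rightarrow> 'n" where
  "mono_perm X i = (THE j. X $ i $ j \<noteq> 0)"

definition act :: "(complex^'k^'k) \<times> (complex^'l^'l) \<Rightarrow> ('k::finite, 'l::finite) datum \<Rightarrow> ('k, 'l) datum" where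
  "act = (\<lambda>(X1, X2) (S, (a, b)).
     (X1 ** S ** matrix_inv X2,
      (\<chi> i. a $ mono_perm X1 i, \<chi> j. b $ mono_perm X2 j)))"

definition orbit :: "('k::finite, 'l::finite) datum \<Rightarrow> ('k, 'l) datum set" where
  "orbit d = (\<lambda>X. act X d) ` (monomial_mats \<times> monomial_mats)"

definition orbit_space :: "('k::finite, 'l::finite) datum set set" where
  "orbit_space = orbit ` V_tilde"

text \<open>The map sending an orbit to the isomorphism class of its members.\<close>

definition orbit_class :: "('k::finite, 'l::finite) datum set \<Rightarrow> ('k + 'l) pb_rep set" where
  "orbit_class Q = (\<Union>d\<in>Q. iso_rel `` {V_rep d})"

text \<open>The exceptional representations: \<open>e\<close> acts as zero, so they factor through the degenerate affine
  Hecke algebra, and the \<open>+1\<close>-eigenspace of \<open>y\<^sub>1 - y\<^sub>2\<close> is not a subrepresentation. No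
  \<open>V_rep d\<close> has the second property. They exist only for \<open>k = \<ell> = 1\<close>, for instance
  \<open>y\<^sub>1 = diag (c, c - 1)\<close>, \<open>y\<^sub>2 = diag (c - 1, c)\<close>, \<open>e = 0\<close> and \<open>s\<close> with rows
  \<open>(-1, 0)\<close> and \<open>(1, 1)\<close>. This representation is indecomposable, calibrated and has
  regular eigenvalues, but is not isomorphic to any \<open>V_rep d\<close>; so a parametrization of the
  whole of \<^const>\<open>regular_indecomposables\<close> fails for \<open>k = \<ell> = 1\<close>.\<close>

definition hecke_exceptional :: "('k::finite + 'l::finite) pb_rep set" where
  "hecke_exceptional =
     {\<rho> \<in> regular_indecomposables.
        \<rho> pb_e = 0 \<and> \<not> subrep \<rho> {v. \<rho> (pb_y1 - pb_y2) *v v = v}}"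

end

theory Submission
  imports Defs
begin

text \<open>On a regular representation the simultaneous eigenspaces of \<open>y\<^sub>1\<close> and \<open>y\<^sub>1 - y\<^sub>2\<close> are lines. So an
  intertwiner between two representations \<open>V(S; (a, b))\<close> is a block diagonal matrix
  \<open>diag (X\<^sub>1, X\<^sub>2)\<close> with monomial blocks and \<open>X\<^sub>1 S = S' X\<^sub>2\<close>, which is the group action. In an
  eigenbasis the relations force \<open>e\<close> to be strictly block upper triangular and the diagonal blocks
  of \<open>s\<close> to be \<open>-1\<close> and \<open>1\<close>. A nonzero lower left entry of \<open>s\<close> splits off a
  two-dimensional summand, the exceptional case. Otherwise the representation is
  \<open>V(S; (a, b))\<close>, and its idempotent endomorphisms are the indicators of unions of connected
  components of the bipartite graph of nonzero entries of \<open>S\<close>. That graph is connected exactly if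
  \<open>S\<close> is rhizomatic.\<close>

section \<open>Representations and intertwiners\<close>

text \<open>Every class in the quotient is a sum of scalar multiples of words. So a property closed
  under sums and products need only be checked on scalars and generators.\<close>

lemma pb_alg_induct [case_names const gen add mult]:
  assumes const: "\<And>c. P (pb_const c)" and gen: "\<And>g. P (pb_of g)"
    and add: "\<And>x y. P x \<Longrightarrow> P y \<Longrightarrow> P (x + y)" and mult: "\<And>x y. P x \<Longrightarrow> P y \<Longrightarrow> P (x * y)"
  shows "P x"
proof -
  have word: "P (abs_pb_alg (Poly_Mapping.single w 1))" for w
  proof (induction w)
    case Nil
    have "abs_pb_alg (Poly_Mapping.single [] 1) = pb_const 1"
      by (simp add: pb_const.abs_eq flip: zero_list_def)
    then show ?case using const by simp
  next
    case (Cons g w)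
    have "abs_pb_alg (Poly_Mapping.single (g # w) 1) =
        pb_of g * abs_pb_alg (Poly_Mapping.single w 1)"
      by (simp add: pb_of.abs_eq times_pb_alg.abs_eq free_gen_def mult_single plus_list_def)
    then show ?case using gen mult Cons by simp
  qed
  have "P (abs_pb_alg p)" for p
  proof (induction p rule: free_alg_induct)
    case zero
    have "abs_pb_alg 0 = pb_const 0" by (simp add: pb_const.abs_eq)
    then show ?case using const by simp
  next
    case (add w c q)
    have "abs_pb_alg (Poly_Mapping.single w c + q) =
        pb_const c * abs_pb_alg (Poly_Mapping.single w 1) + abs_pb_alg q"
      by (simp add: pb_const.abs_eq times_pb_alg.abs_eq plus_pb_alg.abs_eq mult_single)
    then show ?case using add const word assms(3) mult by simp
  qed
  then show ?thesis
    using Quotient3_abs_rep [OF Quotient3_pb_alg] by metis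
qed

lemma pb_alg_relation:
  assumes "(l, r) \<in> pb_relations"
  shows "abs_pb_alg l = abs_pb_alg r"
  using pb_ideal.rel [OF assms] by (simp add: pb_alg.abs_eq_iff)

lemma pb_alg_relations:
  "pb_s * pb_s = 1" "pb_y1 * pb_y2 = pb_y2 * pb_y1"
  "pb_s * pb_y1 = pb_y2 * pb_s - 1 - pb_e" "pb_s * pb_y2 = pb_y1 * pb_s + 1 - pb_e"
  "pb_e * pb_e = 0" "pb_e * pb_s = pb_e" "pb_s * pb_e = - pb_e"
  "pb_e * pb_y2 = pb_e * pb_y1 + pb_e" "pb_y1 * pb_e = pb_y2 * pb_e + pb_e"
  by (simp only: pb_of.abs_eq times_pb_alg.abs_eq plus_pb_alg.abs_eq minus_pb_alg.abs_eq
      uminus_pb_alg.abs_eq zero_pb_alg.abs_eq one_pb_alg.abs_eq,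
      rule pb_alg_relation, simp add: pb_relations_def Let_def)+

lemma
  assumes "is_rep \<rho>"
  shows rep_add: "\<rho> (x + y) = \<rho> x + \<rho> y"
    and rep_mult: "\<rho> (x * y) = \<rho> x ** \<rho> y"
    and rep_const: "\<rho> (pb_const c) = mat c"
  using assms by (auto simp: is_rep_def)

lemma rep_zero: "is_rep \<rho> \<Longrightarrow> \<rho> 0 = 0"
  using rep_add [of \<rho> 0 0] by simp

lemma rep_one: "is_rep \<rho> \<Longrightarrow> \<rho> 1 = mat 1"
  using rep_const [of \<rho> 1] by (simp add: pb_const.abs_eq one_pb_alg.abs_eq)

lemma rep_uminus: "is_rep \<rho> \<Longrightarrow> \<rho> (- x) = - \<rho> x"
  using rep_add [of \<rho> x "- x"] by (simp add: rep_zero eq_neg_iff_add_eq_0 add.commute)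

lemma rep_diff: "is_rep \<rho> \<Longrightarrow> \<rho> (x - y) = \<rho> x - \<rho> y"
  using rep_add [of \<rho> x "- y"] by (simp add: rep_uminus)

lemma rep_satisfies_relations:
  assumes "is_rep \<rho>"
  shows "satisfies_relations (\<lambda>g. \<rho> (pb_of g))"
  unfolding satisfies_relations_iff Let_def
  by (simp add: pb_alg_relations rep_add rep_one rep_zero rep_uminus rep_diff assms
      flip: rep_mult [OF assms])

text \<open>The condition on \<open>x\<close> survives sums and products, and scalar matrices
  commute with \<open>P\<close>. This reduces all later questions about isomorphisms and
  endomorphisms to four matrix equations.\<close>

lemma intertwinerI:
  fixes \<rho> \<rho>' :: "('n::finite) pb_rep"
  assumes "is_rep \<rho>" "is_rep \<rho>'" and gen: "\<And>g. P ** \<rho> (pb_of g) = \<rho>' (pb_of g) ** P"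
  shows "P ** \<rho> x = \<rho>' x ** P"
proof (induction x rule: pb_alg_induct)
  case (mult x y)
  have "P ** \<rho> (x * y) = (P ** \<rho> x) ** \<rho> y"
    by (simp add: rep_mult assms matrix_mul_assoc)
  also have "\<dots> = \<rho>' x ** (P ** \<rho> y)"
    by (simp add: mult flip: matrix_mul_assoc)
  also have "\<dots> = \<rho>' (x * y) ** P"
    by (simp add: rep_mult assms mult matrix_mul_assoc)
  finally show ?case .
qed (simp_all add: rep_const rep_add assms gen mat_commute [of _ P] matrix_add_ldistrib
      matrix_distrib_right)

lemma subrepI:
  assumes "is_rep \<rho>" "vec.subspace U" "\<And>g v. v \<in> U \<Longrightarrow> \<rho> (pb_of g) *v v \<in> U"
  shows "subrep \<rho> U"
proof -
  have "\<forall>v\<in>U. \<rho> x *v v \<in> U" for x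
  proof (induction x rule: pb_alg_induct)
    case (const c)
    have "mat c *v v = c *s v" for v :: "complex^'a"
      by (simp add: vec_eq_iff matrix_vector_mult_def mat_def if_distrib [where f = "\<lambda>x. x * _"]
          cong: if_cong)
    then show ?case
      using assms by (simp add: rep_const vec.subspace_scale)
  qed (use assms in \<open>auto simp: rep_add rep_mult matrix_vector_mult_add_rdistrib
      vec.subspace_add simp flip: matrix_vector_mul_assoc\<close>)
  then show ?thesis
    using assms by (simp add: subrep_def)
qed

lemma invertible_matrix_inv:
  fixes P :: "complex^'n^'n"
  assumes "invertible P"
  shows "P ** matrix_inv P = mat 1" "matrix_inv P ** P = mat 1"
  using someI_ex [OF assms [unfolded invertible_def]] by (simp_all add: matrix_inv_def)

lemma rep_iso_refl: "rep_iso \<rho> \<rho>"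
  unfolding rep_iso_def by (rule exI [of _ "mat 1"]) (auto simp: invertible_def intro: exI [of _ "mat 1"])

lemma rep_iso_sym:
  assumes "rep_iso \<rho> \<rho>'"
  shows "rep_iso \<rho>' \<rho>"
proof -
  obtain P where P: "invertible P" "\<And>x. P ** \<rho> x = \<rho>' x ** P"
    using assms by (auto simp: rep_iso_def)
  let ?Q = "matrix_inv P"
  have "?Q ** \<rho>' x = \<rho> x ** ?Q" for x
  proof -
    have "?Q ** \<rho>' x = ?Q ** (\<rho>' x ** P) ** ?Q"
      by (simp add: invertible_matrix_inv P(1) flip: matrix_mul_assoc)
    also have "\<dots> = ?Q ** P ** \<rho> x ** ?Q"
      by (simp add: P(2) [symmetric] matrix_mul_assoc)
    also have "\<dots> = \<rho> x ** ?Q"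
      by (simp add: invertible_matrix_inv P(1))
    finally show ?thesis .
  qed
  moreover have "invertible ?Q"
    using invertible_matrix_inv [OF P(1)] by (auto simp: invertible_def)
  ultimately show ?thesis by (auto simp: rep_iso_def)
qed

lemma rep_iso_trans:
  assumes "rep_iso \<rho> \<rho>'" "rep_iso \<rho>' \<rho>''"
  shows "rep_iso \<rho> \<rho>''"
proof -
  obtain P Q where P: "invertible P" "\<And>x. P ** \<rho> x = \<rho>' x ** P"
    and Q: "invertible Q" "\<And>x. Q ** \<rho>' x = \<rho>'' x ** Q"
    using assms by (auto simp: rep_iso_def)
  have "(Q ** P) ** \<rho> x = \<rho>'' x ** (Q ** P)" for x
    by (metis P(2) Q(2) matrix_mul_assoc)
  then show ?thesis
    using invertible_mult [OF Q(1) P(1)] by (auto simp: rep_iso_def)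
qed

section \<open>Direct sum decompositions and idempotent endomorphisms\<close>

text \<open>An idempotent endomorphism splits the space into its range and its kernel, both
  invariant. Conversely, the projection attached to a decomposition into invariant subspaces is an
  idempotent endomorphism.\<close>

lemma indecomposable_iff:
  fixes \<rho> :: "('n::finite) pb_rep"
  shows "indecomposable \<rho> \<longleftrightarrow>
     (\<forall>E. E ** E = E \<longrightarrow> (\<forall>x. E ** \<rho> x = \<rho> x ** E) \<longrightarrow> E = 0 \<or> E = mat 1)"
proof (intro iffI allI impI)
  fix E :: "complex^'n^'n"
  assume ind: "indecomposable \<rho>" and EE: "E ** E = E" and com: "\<forall>x. E ** \<rho> x = \<rho> x ** E"
  have EEv: "E *v (E *v v) = E *v v" for v
    by (simp add: EE matrix_vector_mul_assoc)
  have comv: "\<rho> x *v (E *v v) = E *v (\<rho> x *v v)" for x v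
    by (simp add: com matrix_vector_mul_assoc)
  let ?U = "range ((*v) E)" and ?W = "{v. E *v v = 0}"
  have "subrep \<rho> ?U"
    unfolding subrep_def
  proof
    show "vec.subspace ?U"
      by (rule vec.linear_subspace_image [OF matrix_vector_mul_linear_gen vec.subspace_UNIV])
  qed (auto simp: comv)
  moreover have "subrep \<rho> ?W"
    by (auto simp: subrep_def vec.subspace_def matrix_vector_right_distrib vec.scale comv [symmetric])
  moreover have "?U \<inter> ?W = {0}"
    using EEv by (auto simp: image_iff) (metis matrix_vector_mult_0_right)+
  moreover have "{u + w | u w. u \<in> ?U \<and> w \<in> ?W} = UNIV"
  proof -
    have "v = E *v v + (v - E *v v)" "v - E *v v \<in> ?W" for v
      by (simp_all add: matrix_vector_mult_diff_distrib EEv)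
    then show ?thesis by blast
  qed
  ultimately have "?U = {0} \<or> ?W = {0}"
    using ind unfolding indecomposable_def by blast
  then show "E = 0 \<or> E = mat 1"
  proof
    assume "?U = {0}"
    then have "E *v v = 0" for v by blast
    then show ?thesis by (simp add: matrix_eq)
  next
    assume "?W = {0}"
    moreover have "v - E *v v \<in> ?W" for v
      by (simp add: matrix_vector_mult_diff_distrib EEv)
    ultimately have "E *v v = v" for v by fastforce
    then show ?thesis by (simp add: matrix_eq)
  qed
next
  assume idem: "\<forall>E. E ** E = E \<longrightarrow> (\<forall>x. E ** \<rho> x = \<rho> x ** E) \<longrightarrow> E = 0 \<or> E = mat 1"
  show "indecomposable \<rho>"
    unfolding indecomposable_def
  proof (rule notI, elim exE conjE)
    fix U W
    assume U: "subrep \<rho> U" and W: "subrep \<rho> W" and U0: "U \<noteq> {0}" and W0: "W \<noteq> {0}"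
      and UW: "U \<inter> W = {0}" and sum: "{u + w | u w. u \<in> U \<and> w \<in> W} = UNIV"
    have sU: "vec.subspace U" and sW: "vec.subspace W"
      using U W by (auto simp: subrep_def)
    \<comment> \<open>\<open>f\<close> is the projection onto \<open>U\<close> along
      \<open>W\<close>. Its linearity and its compatibility with the action both come from
      uniqueness of the decomposition, in the form \<open>f_eq\<close>.\<close>
    define f where "f v = (THE u. u \<in> U \<and> v - u \<in> W)" for v
    have f_eq: "f v = u" if "u \<in> U" "v - u \<in> W" for v u
      unfolding f_def
    proof (rule the_equality)
      fix u' assume u': "u' \<in> U \<and> v - u' \<in> W"
      have "u' - u \<in> U" using u' that sU by (simp add: vec.subspace_diff)
      moreover have "u' - u \<in> W"
        using vec.subspace_diff [OF sW that(2), of "v - u'"] u' by simp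
      ultimately have "u' - u \<in> U \<inter> W" by blast
      then show "u' = u" by (simp add: UW)
    qed (use that in auto)
    have f: "f v \<in> U" "v - f v \<in> W" for v
    proof -
      obtain u w where "v = u + w" "u \<in> U" "w \<in> W"
        using sum by blast
      then show "f v \<in> U" "v - f v \<in> W"
        using f_eq [of u v] by auto
    qed
    have "Vector_Spaces.linear (*s) (*s) f"
    proof (unfold Vector_Spaces.linear_iff, intro conjI allI)
      fix x y c
      have "x + y - (f x + f y) = (x - f x) + (y - f y)" by simp
      then show "f (x + y) = f x + f y"
        by (intro f_eq) (metis f sU sW vec.subspace_add)+
      have "c *s x - c *s f x = c *s (x - f x)" by (simp add: vec.scale_right_diff_distrib)
      then show "f (c *s x) = c *s f x"
        by (intro f_eq) (metis f sU sW vec.subspace_scale)+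
    qed (rule vec.vector_space_axioms)+
    then have mf: "matrix f *v v = f v" for v
      by (rule matrix_works)
    have fU: "f u = u" if "u \<in> U" for u
      using f_eq [of u u] that sW by (simp add: vec.subspace_0)
    have fW: "f w = 0" if "w \<in> W" for w
      using f_eq [of 0 w] that sU by (simp add: vec.subspace_0)
    have "matrix f ** matrix f = matrix f"
      by (simp add: matrix_eq mf fU f flip: matrix_vector_mul_assoc)
    moreover have "matrix f ** \<rho> x = \<rho> x ** matrix f" for x
    proof -
      have "f (\<rho> x *v v) = \<rho> x *v f v" for v
        by (rule f_eq) (use U W f in \<open>auto simp: subrep_def simp flip: matrix_vector_mult_diff_distrib\<close>)
      then show ?thesis
        by (simp add: matrix_eq mf flip: matrix_vector_mul_assoc)
    qed
    ultimately have "matrix f = 0 \<or> matrix f = mat 1"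
      using idem by blast
    then show False
    proof
      assume "matrix f = 0"
      then have "f u = 0" for u using mf [of u] by simp
      then have "U \<subseteq> {0}" using fU by fastforce
      then show False using U0 sU vec.subspace_0 by blast
    next
      assume "matrix f = mat 1"
      then have "f u = u" for u using mf [of u] by simp
      then have "W \<subseteq> {0}" using fW by fastforce
      then show False using W0 sW vec.subspace_0 by blast
    qed
  qed
qed

text \<open>Conjugation by the isomorphism turns idempotent endomorphisms of \<open>\<rho>'\<close>
  into idempotent endomorphisms of \<open>\<rho>\<close>, and only 0 and 1 become 0 and 1.\<close>

lemma indecomposable_rep_iso:
  fixes \<rho> \<rho>' :: "('n::finite) pb_rep"
  assumes "rep_iso \<rho> \<rho>'" "indecomposable \<rho>"
  shows "indecomposable \<rho>'"
  unfolding indecomposable_iff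
proof (intro allI impI)
  obtain P where P: "invertible P" "\<And>x. P ** \<rho> x = \<rho>' x ** P"
    using assms by (auto simp: rep_iso_def)
  define Q where "Q = matrix_inv P"
  have PQ: "P ** Q = mat 1" "Q ** P = mat 1"
    using invertible_matrix_inv [OF P(1)] by (auto simp: Q_def)
  fix E assume EE: "E ** E = E" and com: "\<forall>x. E ** \<rho>' x = \<rho>' x ** E"
  let ?F = "Q ** E ** P"
  have PF: "P ** ?F = E ** P"
    by (simp add: PQ matrix_mul_assoc)
  have "?F ** ?F = Q ** E ** (P ** ?F)"
    by (simp add: matrix_mul_assoc)
  also have "\<dots> = Q ** (E ** E) ** P"
    by (simp only: PF) (simp only: matrix_mul_assoc)
  finally have "?F ** ?F = ?F" by (simp add: EE)
  moreover have "?F ** \<rho> x = \<rho> x ** ?F" for x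
  proof -
    have "P ** (?F ** \<rho> x) = P ** ?F ** \<rho> x" by (simp only: matrix_mul_assoc)
    also have "\<dots> = E ** (P ** \<rho> x)" by (simp only: PF) (simp only: matrix_mul_assoc)
    also have "\<dots> = (\<rho>' x ** E) ** P" using com by (simp add: P matrix_mul_assoc)
    also have "\<dots> = \<rho>' x ** (P ** ?F)" by (simp only: PF) (simp only: matrix_mul_assoc)
    also have "\<dots> = P ** (\<rho> x ** ?F)" by (metis P(2) matrix_mul_assoc)
    finally have "Q ** (P ** (?F ** \<rho> x)) = Q ** (P ** (\<rho> x ** ?F))" by simp
    then show ?thesis
      by (metis PQ(2) matrix_mul_assoc matrix_mul_lid)
  qed
  ultimately have "?F = 0 \<or> ?F = mat 1"
    using assms(2) by (simp add: indecomposable_iff)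
  moreover have "E = P ** ?F ** Q"
    by (simp only: PF) (simp add: PQ flip: matrix_mul_assoc)
  ultimately show "E = 0 \<or> E = mat 1"
    by (auto simp: PQ)
qed

text \<open>This is the change to the basis formed by the columns of \<open>P\<close>; it serves to
  pass to an eigenbasis.\<close>

lemma is_rep_conjugate:
  assumes "is_rep \<rho>" "invertible P"
  shows "is_rep (\<lambda>x. matrix_inv P ** \<rho> x ** P)"
    and "rep_iso \<rho> (\<lambda>x. matrix_inv P ** \<rho> x ** P)"
proof -
  let ?Q = "matrix_inv P"
  note PQ = invertible_matrix_inv [OF assms(2)]
  have "?Q ** (\<rho> x ** \<rho> y) ** P = ?Q ** \<rho> x ** P ** (?Q ** \<rho> y ** P)" for x y
  proof -
    have "?Q ** \<rho> x ** P ** (?Q ** \<rho> y ** P) = ?Q ** \<rho> x ** (P ** ?Q) ** \<rho> y ** P"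
      by (simp only: matrix_mul_assoc)
    then show ?thesis by (simp add: PQ matrix_mul_assoc)
  qed
  moreover have "?Q ** mat c ** P = mat c" for c
    by (metis PQ(2) mat_commute matrix_mul_assoc matrix_mul_rid)
  ultimately show "is_rep (\<lambda>x. ?Q ** \<rho> x ** P)"
    using assms(1) by (simp add: is_rep_def matrix_add_ldistrib matrix_distrib_right)
  have "?Q ** \<rho> x = ?Q ** \<rho> x ** P ** ?Q" for x
    by (simp add: PQ flip: matrix_mul_assoc)
  moreover have "invertible ?Q"
    using PQ by (auto simp: invertible_def)
  ultimately show "rep_iso \<rho> (\<lambda>x. ?Q ** \<rho> x ** P)"
    by (auto simp: rep_iso_def)
qed

text \<open>No generator has a nonzero entry between \<open>K\<close> and its complement, so the
  coordinate projection onto \<open>K\<close> is an idempotent endomorphism, hence 0 or 1.\<close>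

lemma indecomposable_closed_index_set:
  fixes \<rho> :: "('n::finite) pb_rep"
  assumes "is_rep \<rho>" "indecomposable \<rho>"
    and closed: "\<And>g p q. \<rho> (pb_of g) $ p $ q \<noteq> 0 \<Longrightarrow> p \<in> K \<longleftrightarrow> q \<in> K"
  shows "K = {} \<or> K = UNIV"
proof -
  define E :: "complex^'n^'n" where "E = diag (\<chi> p. if p \<in> K then 1 else 0)"
  have "E ** E = E"
    by (simp add: E_def vec_eq_iff diag_mult_entry) (simp add: diag_def)
  moreover have "E ** \<rho> x = \<rho> x ** E" for x
    by (rule intertwinerI) (use assms in \<open>auto simp: E_def vec_eq_iff diag_mult_entry mult_diag_entry\<close>)
  ultimately have "E = 0 \<or> E = mat 1"
    using assms(2) by (simp add: indecomposable_iff)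
  then have "(\<forall>p. E $ p $ p = 0) \<or> (\<forall>p. E $ p $ p = 1)"
    by (auto simp: mat_def)
  then show ?thesis
    by (auto simp: E_def diag_def split: if_splits)
qed

section \<open>Rhizomatic matrices\<close>

text \<open>Regard rows (\<open>Inl\<close>) and columns (\<open>Inr\<close>) as vertices and
  nonzero entries as edges. The sets \<open>K\<close> are the unions of connected components, so the
  right side says that the graph is connected. An equivalence class of entries is the edge set of a
  component, and a zero row or column is an isolated vertex.\<close>

lemma rhizomatic_iff_connected:
  fixes S :: "complex^('l::finite)^('k::finite)"
  shows "rhizomatic S \<longleftrightarrow>
    (\<forall>K. (\<forall>i j. S $ i $ j \<noteq> 0 \<longrightarrow> (Inl i \<in> K \<longleftrightarrow> Inr j \<in> K)) \<longrightarrow> K = {} \<or> K = UNIV)"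
proof (intro iffI allI impI)
  fix K :: "('k + 'l) set"
  assume rh: "rhizomatic S"
    and K: "\<forall>i j. S $ i $ j \<noteq> 0 \<longrightarrow> (Inl i \<in> K \<longleftrightarrow> Inr j \<in> K)"
  obtain X where X: "nonzero_pos S // rhizo_equiv S = {X}"
    using rh by (auto simp: rhizomatic_def card_1_singleton_iff)
  have equiv: "equivclp (linked S) p q" if "p \<in> nonzero_pos S" "q \<in> nonzero_pos S" for p q
  proof -
    have "rhizo_equiv S `` {p} = X" "rhizo_equiv S `` {q} = X"
      using X that by (auto simp: quotient_def)
    moreover have "q \<in> rhizo_equiv S `` {q}"
      using that by (simp add: rhizo_equiv_def)
    ultimately have "q \<in> rhizo_equiv S `` {p}"
      by simp
    then show ?thesis by (auto simp: rhizo_equiv_def)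
  qed
  \<comment> \<open>Linked entries share a row or a column. In the second case membership in
    \<open>K\<close> passes from one row to the other through the common column.\<close>
  have const: "Inl (fst p) \<in> K \<longleftrightarrow> Inl (fst q) \<in> K" if "equivclp (linked S) p q" for p q
    using that
  proof (induction rule: equivclp_induct)
    case (step q r)
    then have "linked S q r \<or> linked S r q" by auto
    then have "Inl (fst q) \<in> K \<longleftrightarrow> Inl (fst r) \<in> K"
      using K by (cases q; cases r) (auto simp: linked_def nonzero_pos_def)
    with step show ?case by simp
  qed simp
  have row: "\<exists>j. S $ i $ j \<noteq> 0" and col: "\<exists>i. S $ i $ j \<noteq> 0" for i j
    using rh by (auto simp: rhizomatic_def)
  have "Inl i \<in> K \<longleftrightarrow> Inl i' \<in> K" for i i'
  proof -
    obtain j j' where "S $ i $ j \<noteq> 0" "S $ i' $ j' \<noteq> 0" using row by blast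
    then show ?thesis
      using const [OF equiv, of "(i, j)" "(i', j')"] by (simp add: nonzero_pos_def)
  qed
  then have "(\<forall>i. Inl i \<in> K) \<or> (\<forall>i. Inl i \<notin> K)" by blast
  moreover have "\<exists>i. Inr j \<in> K \<longleftrightarrow> Inl i \<in> K" for j
    using K col by blast
  ultimately have "(\<forall>p. p \<in> K) \<or> (\<forall>p. p \<notin> K)"
    by (metis sum.exhaust)
  then show "K = {} \<or> K = UNIV" by blast
next
  assume conn: "\<forall>K. (\<forall>i j. S $ i $ j \<noteq> 0 \<longrightarrow> (Inl i \<in> K \<longleftrightarrow> Inr j \<in> K)) \<longrightarrow> K = {} \<or> K = UNIV"
  \<comment> \<open>A zero row would make the singleton \<open>{Inl i}\<close> a union of
    components, but it is nonempty and misses every \<open>Inr j\<close>. Columns are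
    symmetric.\<close>
  have row: "\<exists>j. S $ i $ j \<noteq> 0" for i
    using conn [rule_format, of "{Inl i}"] by blast
  have col: "\<exists>i. S $ i $ j \<noteq> 0" for j
    using conn [rule_format, of "{Inr j}"] by blast
  obtain p where p: "p \<in> nonzero_pos S"
    using row by (force simp: nonzero_pos_def)
  \<comment> \<open>\<open>C\<close> is the class of \<open>p\<close>, and \<open>K\<close> consists
    of the rows and columns that it meets. Any nonzero entry in such a row or column already belongs
    to \<open>C\<close>.\<close>
  define C where "C = {q \<in> nonzero_pos S. equivclp (linked S) p q}"
  define K where "K = (Inl \<circ> fst) ` C \<union> (Inr \<circ> snd) ` C"
  have ext: "q \<in> C" if "r \<in> C" "q \<in> nonzero_pos S" "fst q = fst r \<or> snd q = snd r" for q r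
  proof -
    have "linked S r q" using that by (auto simp: linked_def C_def)
    then show ?thesis using that by (auto simp: C_def intro: equivclp_into_equivclp)
  qed
  have in_C: "(i, j) \<in> C" if nz: "S $ i $ j \<noteq> 0" and ij: "Inl i \<in> K \<or> Inr j \<in> K" for i j
  proof -
    obtain r where "r \<in> C" "fst r = i \<or> snd r = j"
      using ij by (auto simp: K_def)
    then show ?thesis using nz ext [of r "(i, j)"] by (auto simp: nonzero_pos_def)
  qed
  have "Inl i \<in> K \<longleftrightarrow> Inr j \<in> K" if "S $ i $ j \<noteq> 0" for i j
    using in_C [OF that] by (force simp: K_def)
  moreover have "p \<in> C" using p by (simp add: C_def)
  then have "K \<noteq> {}" by (auto simp: K_def)
  ultimately have "K = UNIV" using conn by blast
  then have C: "equivclp (linked S) p q" if "q \<in> nonzero_pos S" for q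
    using that in_C by (cases q) (auto simp: nonzero_pos_def C_def)
  have "equivclp (linked S) q r" if "q \<in> nonzero_pos S" "r \<in> nonzero_pos S" for q r
    using C [OF that(1)] C [OF that(2)] by (meson equivclp_sym equivclp_trans)
  then have "rhizo_equiv S = nonzero_pos S \<times> nonzero_pos S"
    unfolding rhizo_equiv_def by blast
  then have "nonzero_pos S // rhizo_equiv S = {nonzero_pos S}"
    using p by (auto simp: quotient_def)
  then show "rhizomatic S"
    using row col by (simp add: rhizomatic_def)
qed

section \<open>The representations \<open>V(S; (a, b))\<close>\<close>

lemma block_nth [simp]:
  "block A B C D $ Inl i $ Inl i' = A $ i $ i'" "block A B C D $ Inl i $ Inr j = B $ i $ j"
  "block A B C D $ Inr j $ Inl i = C $ j $ i" "block A B C D $ Inr j $ Inr j' = D $ j $ j'"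
  by (simp_all add: block_def)

lemma vjoin_nth [simp]: "vjoin a b $ Inl i = a $ i" "vjoin a b $ Inr j = b $ j"
  by (simp_all add: vjoin_def)

lemma matrix_sum_eq_iff:
  fixes X Y :: "complex^('k::finite + 'l::finite)^('k + 'l)"
  shows "X = Y \<longleftrightarrow>
    (\<forall>i i'. X $ Inl i $ Inl i' = Y $ Inl i $ Inl i') \<and> (\<forall>i j. X $ Inl i $ Inr j = Y $ Inl i $ Inr j) \<and>
    (\<forall>j i. X $ Inr j $ Inl i = Y $ Inr j $ Inl i) \<and> (\<forall>j j'. X $ Inr j $ Inr j' = Y $ Inr j $ Inr j')"
  by (auto simp: vec_eq_iff) (metis sum.exhaust)

lemma block_eq_iff: "block A B C D = block A' B' C' D' \<longleftrightarrow> A = A' \<and> B = B' \<and> C = C' \<and> D = D'"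
  by (auto simp: matrix_sum_eq_iff vec_eq_iff)

lemma block_exhaust: obtains A B C D where "X = block A B C D"
proof
  show "X = block (\<chi> i i'. X $ Inl i $ Inl i') (\<chi> i j. X $ Inl i $ Inr j)
      (\<chi> j i. X $ Inr j $ Inl i) (\<chi> j j'. X $ Inr j $ Inr j')"
    by (simp add: matrix_sum_eq_iff)
qed

lemma mat_nth: "mat c $ i $ j = (if i = j then c else 0)"
  by (simp add: mat_def)

lemma diag_nth: "diag v $ i $ j = (if i = j then v $ i else 0)"
  by (simp add: diag_def)

lemma V_gen_simps:
  "V_gen (S, (a, b)) GS = block (- mat 1) S 0 (mat 1)"
  "V_gen (S, (a, b)) GY1 = diag (vjoin a (\<chi> j. b $ j - 1))"
  "V_gen (S, (a, b)) GY2 = diag (vjoin (\<chi> i. a $ i - 1) b)"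
  "V_gen (S, (a, b)) GE = block 0 (\<chi> i j. (a $ i - b $ j) * S $ i $ j) 0 0"
  by (simp_all add: V_gen_def Let_def)
     (simp add: matrix_sum_eq_iff diag_mult_entry mult_diag_entry mat_nth algebra_simps)

lemma
  shows is_rep_V_rep: "is_rep (V_rep d)" and V_rep_gen: "V_rep d (pb_of g) = V_gen d g"
  using theI' [OF V_rep_unique_existence [of d]] by (simp_all add: V_rep_def)

lemma V_rep_eqI:
  assumes "is_rep \<rho>" "\<And>g. \<rho> (pb_of g) = V_gen d g"
  shows "\<rho> = V_rep d"
  using V_rep_unique_existence [of d] assms is_rep_V_rep V_rep_gen by blast

text \<open>Since \<open>e\<close> is a polynomial in the other generators, a matrix that
  intertwines \<open>s\<close>, \<open>y1\<close> and \<open>y2\<close> also intertwines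
  \<open>e\<close>.\<close>

lemma relation_solved_for_e:
  assumes "satisfies_relations M"
  shows "M GE = M GY2 ** M GS - mat 1 - M GS ** M GY1"
  using assms by (simp add: satisfies_relations_iff Let_def)

lemma matrix_diff_rdistrib: "(A - B) ** C = A ** C - B ** (C :: complex^'p^'n)"
  by (simp add: vec_eq_iff matrix_matrix_mult_def left_diff_distrib sum_subtractf)

lemma matrix_diff_ldistrib: "C ** (A - B) = C ** A - C ** (B :: complex^'p^'n)"
  for C :: "complex^'n^'m"
  by (simp add: vec_eq_iff matrix_matrix_mult_def right_diff_distrib sum_subtractf)

lemma matrix_mult_uminus:
  fixes A :: "complex^'m^'n" and B :: "complex^'p^'m"
  shows "- A ** B = - (A ** B)" "A ** (- B) = - (A ** B)"
  by (simp_all add: matrix_matrix_mult_def vec_eq_iff sum_negf)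

lemma intertwine_mult:
  assumes "Q ** A = A' ** Q" "Q ** B = B' ** Q"
  shows "Q ** (A ** B) = (A' ** B') ** Q"
proof -
  have "Q ** (A ** B) = (A' ** Q) ** B" by (simp add: assms(1) matrix_mul_assoc)
  also have "\<dots> = A' ** (B' ** Q)" by (simp add: assms(2) flip: matrix_mul_assoc)
  finally show ?thesis by (simp add: matrix_mul_assoc)
qed

text \<open>Commuting with the diagonal actions means that a nonzero entry of \<open>Q\<close> joins
  equal eigenvalues. For \<open>y1 - y2\<close> this gives the block form, for \<open>y1\<close> and
  \<open>y2\<close> the conditions on \<open>a\<close> and \<open>b\<close>; what remains of the
  condition for \<open>s\<close> is \<open>X1 ** S = S' ** X2\<close>.\<close>

lemma V_gen_intertwiner_iff:
  fixes Q :: "complex^('k::finite + 'l::finite)^('k + 'l)"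
  shows "(\<forall>g. Q ** V_gen (S, (a, b)) g = V_gen (S', (a', b')) g ** Q) \<longleftrightarrow>
    (\<exists>X1 X2. Q = block X1 0 0 X2 \<and> X1 ** S = S' ** X2 \<and>
       (\<forall>i j. X1 $ i $ j \<noteq> 0 \<longrightarrow> a' $ i = a $ j) \<and> (\<forall>i j. X2 $ i $ j \<noteq> 0 \<longrightarrow> b' $ i = b $ j))"
    (is "?L \<longleftrightarrow> ?R")
proof
  assume ?L
  then have s: "Q ** V_gen (S, (a, b)) GS = V_gen (S', (a', b')) GS ** Q"
    and y1: "Q ** V_gen (S, (a, b)) GY1 = V_gen (S', (a', b')) GY1 ** Q"
    and y2: "Q ** V_gen (S, (a, b)) GY2 = V_gen (S', (a', b')) GY2 ** Q"
    by auto
  obtain X1 Y Z X2 where Q: "Q = block X1 Y Z X2" by (rule block_exhaust)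
  have y1_entry: "Q $ p $ q * vjoin a (\<chi> j. b $ j - 1) $ q = vjoin a' (\<chi> j. b' $ j - 1) $ p * Q $ p $ q"
    and y2_entry: "Q $ p $ q * vjoin (\<chi> i. a $ i - 1) b $ q = vjoin (\<chi> i. a' $ i - 1) b' $ p * Q $ p $ q"
    for p q
    using y1 y2 by (simp_all add: V_gen_simps vec_eq_iff diag_mult_entry mult_diag_entry)
  \<comment> \<open>Subtracting the two entry equations leaves the condition for
    \<open>y1 - y2\<close>, whose eigenvalues on the two blocks are 1 and -1. Thus twice the entry
    is 0, here and for \<open>Z\<close>.\<close>
  have "Y $ i $ j = 0" for i j
    using y1_entry [of "Inl i" "Inr j"] y2_entry [of "Inl i" "Inr j"] by (simp add: Q algebra_simps)
  moreover have "Z $ j $ i = 0" for i j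
    using y1_entry [of "Inr j" "Inl i"] y2_entry [of "Inr j" "Inl i"] by (simp add: Q algebra_simps)
  ultimately have YZ: "Y = 0" "Z = 0" by (simp_all add: vec_eq_iff)
  have "X1 ** S = S' ** X2"
    using s by (simp add: V_gen_simps Q YZ block_mult block_eq_iff)
  moreover have "a' $ i = a $ j" if "X1 $ i $ j \<noteq> 0" for i j
    using y1_entry [of "Inl i" "Inl j"] that by (simp add: Q)
  moreover have "b' $ i = b $ j" if "X2 $ i $ j \<noteq> 0" for i j
    using y2_entry [of "Inr i" "Inr j"] that by (simp add: Q)
  ultimately show ?R
    using Q YZ by auto
next
  assume ?R
  then obtain X1 X2 where Q: "Q = block X1 0 0 X2" and S: "X1 ** S = S' ** X2"
    and a: "\<And>i j. X1 $ i $ j \<noteq> 0 \<Longrightarrow> a' $ i = a $ j" and b: "\<And>i j. X2 $ i $ j \<noteq> 0 \<Longrightarrow> b' $ i = b $ j"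
    by blast
  let ?M = "V_gen (S, (a, b))" and ?M' = "V_gen (S', (a', b'))"
  have s: "Q ** ?M GS = ?M' GS ** Q"
    by (simp add: V_gen_simps Q S block_mult block_eq_iff matrix_mult_uminus)
  have a2: "X1 $ i $ j * a $ j = a' $ i * X1 $ i $ j" for i j
    using a [of i j] by (cases "X1 $ i $ j = 0") simp_all
  have b2: "X2 $ i $ j * b $ j = b' $ i * X2 $ i $ j" for i j
    using b [of i j] by (cases "X2 $ i $ j = 0") simp_all
  have y1: "Q ** ?M GY1 = ?M' GY1 ** Q" and y2: "Q ** ?M GY2 = ?M' GY2 ** Q"
    by (simp_all add: V_gen_simps Q matrix_sum_eq_iff diag_mult_entry mult_diag_entry a2 b2
        left_diff_distrib right_diff_distrib)
  have "Q ** (?M GY2 ** ?M GS) = (?M' GY2 ** ?M' GS) ** Q" "Q ** (?M GS ** ?M GY1) = (?M' GS ** ?M' GY1) ** Q"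
    by (rule intertwine_mult [OF y2 s], rule intertwine_mult [OF s y1])
  then have e: "Q ** ?M GE = ?M' GE ** Q"
    by (simp add: relation_solved_for_e [OF V_gen_satisfies] matrix_diff_ldistrib matrix_diff_rdistrib)
  show ?L
  proof
    show "Q ** ?M g = ?M' g ** Q" for g by (cases g) (simp_all only: s y1 y2 e)
  qed
qed

section \<open>Isomorphisms and the group action\<close>

lemma invertible_block_diagonal:
  assumes "invertible (block X1 0 0 X2)"
  shows "invertible X1" "invertible X2"
proof -
  obtain R where R: "block X1 0 0 X2 ** R = mat 1"
    using assms by (auto simp: invertible_def)
  obtain R1 R2 R3 R4 where "R = block R1 R2 R3 R4" by (rule block_exhaust)
  then have "X1 ** R1 = mat 1" "X2 ** R4 = mat 1"
    using R by (simp_all add: block_mult mat_block block_eq_iff)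
  then show "invertible X1" "invertible X2"
    by (auto simp: invertible_right_inverse)
qed

lemma invertible_nonzero_entry:
  fixes X :: "complex^'n^'n"
  assumes "invertible X"
  shows "\<exists>j. X $ i $ j \<noteq> 0" "\<exists>i. X $ i $ j \<noteq> 0"
proof -
  obtain Y where Y: "X ** Y = mat 1" "Y ** X = mat 1"
    using assms by (auto simp: invertible_def)
  have "(X ** Y) $ i $ i = 1" by (simp add: Y mat_nth)
  then have "(\<Sum>k\<in>UNIV. X $ i $ k * Y $ k $ i) \<noteq> 0" by (simp add: matrix_matrix_mult_def)
  then show "\<exists>j. X $ i $ j \<noteq> 0" by (metis (no_types, lifting) mult_zero_left sum.neutral)
  have "(Y ** X) $ j $ j = 1" by (simp add: Y mat_nth)
  then have "(\<Sum>k\<in>UNIV. Y $ j $ k * X $ k $ j) \<noteq> 0" by (simp add: matrix_matrix_mult_def)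
  then show "\<exists>i. X $ i $ j \<noteq> 0" by (metis (no_types, lifting) mult_zero_right sum.neutral)
qed

section \<open>Monomial matrices\<close>

lemma monomial_mats_unique:
  assumes "X \<in> monomial_mats"
  shows "X $ i $ j \<noteq> 0 \<Longrightarrow> X $ i $ j' \<noteq> 0 \<Longrightarrow> j = j'"
    and "X $ i $ j \<noteq> 0 \<Longrightarrow> X $ i' $ j \<noteq> 0 \<Longrightarrow> i = i'"
  using assms unfolding monomial_mats_def by blast+

lemma mono_perm_iff:
  assumes "X \<in> monomial_mats"
  shows "X $ i $ j \<noteq> 0 \<longleftrightarrow> j = mono_perm X i"
proof -
  have "\<exists>!j. X $ i $ j \<noteq> 0" using assms by (simp add: monomial_mats_def)
  from theI' [OF this] this show ?thesis
    unfolding mono_perm_def by blast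
qed

lemma inj_mono_perm: "X \<in> monomial_mats \<Longrightarrow> inj (mono_perm X)"
  by (rule injI) (metis mono_perm_iff monomial_mats_unique(2))

lemma invertible_monomial:
  fixes X :: "complex^'n^'n"
  assumes "X \<in> monomial_mats"
  shows "invertible X"
proof -
  \<comment> \<open>The inverse is the transpose with all nonzero entries inverted; zero entries
    stay zero because \<open>inverse 0 = 0\<close>.\<close>
  let ?Y = "\<chi> j i. inverse (X $ i $ j)"
  have "(\<Sum>k\<in>UNIV. X $ i $ k * inverse (X $ i' $ k)) = (if i = i' then 1 else 0)" for i i'
  proof -
    have "X $ i $ k * inverse (X $ i' $ k) = (if k = mono_perm X i then if i = i' then 1 else 0 else 0)"
      for k
      using mono_perm_iff [OF assms, of i k] monomial_mats_unique(2) [OF assms, of i k i'] by auto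
    then show ?thesis by simp
  qed
  then have "X ** ?Y = mat 1"
    by (simp add: vec_eq_iff matrix_matrix_mult_def mat_nth)
  then show ?thesis by (auto simp: invertible_right_inverse)
qed

text \<open>Distinct entries of \<open>a\<close> allow at most one nonzero entry per row of
  \<open>X\<close>, and distinct entries of \<open>a'\<close> at most one per column. Invertibility
  supplies at least one.\<close>

lemma monomial_of_eigenvalues:
  fixes X :: "complex^'n^'n"
  assumes "invertible X" "\<And>i j. X $ i $ j \<noteq> 0 \<Longrightarrow> a' $ i = a $ j"
    and "\<And>i j. i \<noteq> j \<Longrightarrow> a $ i \<noteq> a $ j" "\<And>i j. i \<noteq> j \<Longrightarrow> a' $ i \<noteq> a' $ j"
  shows "X \<in> monomial_mats" "a' = (\<chi> i. a $ mono_perm X i)"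
proof -
  show X: "X \<in> monomial_mats"
    unfolding monomial_mats_def using invertible_nonzero_entry [OF assms(1)] assms(2-) by simp metis
  show "a' = (\<chi> i. a $ mono_perm X i)"
    using assms(2) mono_perm_iff [OF X] by (simp add: vec_eq_iff)
qed

text \<open>The group element, read as a block diagonal matrix, is itself the isomorphism.\<close>

lemma rep_iso_if_orbit:
  assumes "d' \<in> orbit d"
  shows "rep_iso (V_rep d) (V_rep d')"
proof -
  obtain S a b where d: "d = (S, (a, b))" by (metis prod.exhaust)
  obtain X1 X2 where X: "X1 \<in> monomial_mats" "X2 \<in> monomial_mats" and d': "d' = act (X1, X2) d"
    using assms by (auto simp: orbit_def)
  have inv: "invertible X1" "invertible X2"
    using X invertible_monomial by auto
  let ?Q = "block X1 0 0 X2"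
  have "invertible ?Q"
    unfolding invertible_right_inverse
  proof
    show "?Q ** block (matrix_inv X1) 0 0 (matrix_inv X2) = mat 1"
      by (simp add: block_mult mat_block invertible_matrix_inv inv)
  qed
  moreover have "X1 ** S ** matrix_inv X2 ** X2 = X1 ** S"
    by (simp add: invertible_matrix_inv inv flip: matrix_mul_assoc)
  then have "\<forall>g. ?Q ** V_gen d g = V_gen d' g ** ?Q"
    unfolding d d' act_def prod.case V_gen_intertwiner_iff
    by (intro exI [of _ X1] exI [of _ X2]) (simp add: mono_perm_iff X)
  ultimately show ?thesis
    using intertwinerI [OF is_rep_V_rep is_rep_V_rep, of ?Q d d']
    by (auto simp: rep_iso_def V_rep_gen)
qed

text \<open>An isomorphism is block diagonal, and distinct eigenvalues make its blocks monomial. It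
  is therefore a group element, and solving \<open>X1 ** S = S' ** X2\<close> for \<open>S'\<close>
  gives its action.\<close>

lemma orbit_if_rep_iso:
  assumes "rep_iso (V_rep d) (V_rep d')" "snd d \<in> reg" "snd d' \<in> reg"
  shows "d' \<in> orbit d"
proof -
  obtain S a b S' a' b' where d: "d = (S, (a, b))" "d' = (S', (a', b'))" by (metis prod.exhaust)
  obtain Q where Q: "invertible Q" "\<forall>x. Q ** V_rep d x = V_rep d' x ** Q"
    using assms(1) by (auto simp: rep_iso_def)
  then have "\<forall>g. Q ** V_gen d g = V_gen d' g ** Q"
    by (simp flip: V_rep_gen)
  then obtain X1 X2 where QX: "Q = block X1 0 0 X2" and S: "X1 ** S = S' ** X2"
    and a: "\<And>i j. X1 $ i $ j \<noteq> 0 \<Longrightarrow> a' $ i = a $ j" and b: "\<And>i j. X2 $ i $ j \<noteq> 0 \<Longrightarrow> b' $ i = b $ j"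
    unfolding d V_gen_intertwiner_iff by blast
  have inv: "invertible X1" "invertible X2"
    using Q(1) invertible_block_diagonal by (auto simp: QX)
  have X1: "X1 \<in> monomial_mats" "a' = (\<chi> i. a $ mono_perm X1 i)"
    by (rule monomial_of_eigenvalues [OF inv(1) a]; use assms in \<open>auto simp: d reg_def\<close>)+
  have X2: "X2 \<in> monomial_mats" "b' = (\<chi> i. b $ mono_perm X2 i)"
    by (rule monomial_of_eigenvalues [OF inv(2) b]; use assms in \<open>auto simp: d reg_def\<close>)+
  have "S' = X1 ** S ** matrix_inv X2"
    unfolding S by (simp add: invertible_matrix_inv inv flip: matrix_mul_assoc)
  then have "d' = act (X1, X2) d"
    using X1(2) X2(2) by (simp add: d act_def)
  then show ?thesis
    using X1(1) X2(1) by (auto simp: orbit_def)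
qed

section \<open>Orbits as equivalence classes\<close>

text \<open>Permuting coordinates keeps them distinct. This makes \<open>orbit_if_rep_iso\<close>
  applicable to every member of an orbit.\<close>

lemma orbit_reg:
  assumes "d' \<in> orbit d" "snd d \<in> reg"
  shows "snd d' \<in> reg"
proof -
  obtain S a b where d: "d = (S, (a, b))" by (metis prod.exhaust)
  obtain X1 X2 where X: "X1 \<in> monomial_mats" "X2 \<in> monomial_mats" and d': "d' = act (X1, X2) d"
    using assms(1) by (auto simp: orbit_def)
  show ?thesis
    using assms(2) X [THEN inj_mono_perm] by (simp add: d d' act_def reg_def inj_eq)
qed

lemma orbit_self: "d \<in> V_tilde \<Longrightarrow> d \<in> orbit d"
  by (rule orbit_if_rep_iso) (auto simp: rep_iso_refl V_tilde_def)

text \<open>Symmetry and transitivity are taken from \<open>rep_iso\<close>, through the two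
  preceding translations, in place of the group laws for \<open>act\<close>.\<close>

lemma orbit_eq_if_rep_iso:
  assumes "d \<in> V_tilde" "d' \<in> V_tilde" "rep_iso (V_rep d) (V_rep d')"
  shows "orbit d = orbit d'"
proof -
  have "orbit d \<subseteq> orbit d'"
    if "d \<in> V_tilde" "d' \<in> V_tilde" "rep_iso (V_rep d) (V_rep d')"
    for d d' :: "('k::finite, 'l::finite) datum"
  proof
    fix x assume x: "x \<in> orbit d"
    then have "rep_iso (V_rep d') (V_rep x)"
      using rep_iso_if_orbit rep_iso_sym rep_iso_trans that(3) by blast
    moreover have "snd d' \<in> reg" "snd d \<in> reg" using that by (auto simp: V_tilde_def)
    ultimately show "x \<in> orbit d'"
      using orbit_if_rep_iso orbit_reg [OF x] by blast
  qed
  from this [OF assms] this [OF assms(2,1) rep_iso_sym [OF assms(3)]] show ?thesis by blast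
qed

section \<open>Classification\<close>

text \<open>By regularity an endomorphism is diagonal, and commuting with \<open>s\<close> makes its
  diagonal entries agree at both ends of each edge of the graph of \<open>S\<close>. Connectedness
  makes it scalar, and an idempotent scalar is 0 or 1.\<close>

lemma indecomposable_V_rep:
  fixes d :: "('k::finite, 'l::finite) datum"
  assumes "d \<in> V_tilde"
  shows "indecomposable (V_rep d)"
  unfolding indecomposable_iff
proof (intro allI impI)
  obtain S a b where d: "d = (S, (a, b))" by (metis prod.exhaust)
  have a_inj: "i = j" if "a $ i = a $ j" for i j
    using assms that by (auto simp: d V_tilde_def reg_def)
  have b_inj: "i = j" if "b $ i = b $ j" for i j
    using assms that by (auto simp: d V_tilde_def reg_def)
  fix E assume EE: "E ** E = E" and com: "\<forall>x. E ** V_rep d x = V_rep d x ** E"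
  from com have "\<forall>g. E ** V_gen d g = V_gen d g ** E"
    by (simp flip: V_rep_gen)
  then obtain X1 X2 where E: "E = block X1 0 0 X2" and S: "X1 ** S = S ** X2"
    and "\<And>i j. X1 $ i $ j \<noteq> 0 \<Longrightarrow> a $ i = a $ j" and "\<And>i j. X2 $ i $ j \<noteq> 0 \<Longrightarrow> b $ i = b $ j"
    unfolding d V_gen_intertwiner_iff by blast
  then have a: "\<And>i j. X1 $ i $ j \<noteq> 0 \<Longrightarrow> i = j" and b: "\<And>i j. X2 $ i $ j \<noteq> 0 \<Longrightarrow> i = j"
    using a_inj b_inj by blast+
  have X: "X1 = diag (\<chi> i. X1 $ i $ i)" "X2 = diag (\<chi> i. X2 $ i $ i)"
    using a b by (auto simp: vec_eq_iff diag_nth)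
  have S_entry: "X1 $ i $ i * S $ i $ j = S $ i $ j * X2 $ j $ j" for i j
  proof -
    have "(diag (\<chi> i. X1 $ i $ i) ** S) $ i $ j = (S ** diag (\<chi> i. X2 $ i $ i)) $ i $ j"
      using S X by simp
    then show ?thesis by (simp add: diag_mult_entry mult_diag_entry)
  qed
  \<comment> \<open>\<open>p\<close> is an arbitrary reference vertex. The set of vertices with the
    same diagonal entry as \<open>p\<close> is a nonempty union of components.\<close>
  define p :: "'k + 'l" where "p = undefined"
  define c where "c = E $ p $ p"
  let ?K = "{q. E $ q $ q = c}"
  have "Inl i \<in> ?K \<longleftrightarrow> Inr j \<in> ?K" if "S $ i $ j \<noteq> 0" for i j
    using S_entry [of i j] that by (simp add: E)
  moreover have "p \<in> ?K" by (simp add: c_def)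
  moreover have "rhizomatic S" using assms by (simp add: d V_tilde_def)
  ultimately have "?K = UNIV"
    unfolding rhizomatic_iff_connected by blast
  then have "E $ q $ q = c" for q by blast
  from this [of "Inl _"] this [of "Inr _"] have "E = mat c"
    using a b by (fastforce simp: E matrix_sum_eq_iff mat_nth)
  moreover from this EE have "c * c = c"
    by (metis mat_nth mat_times)
  ultimately show "E = 0 \<or> E = mat 1"
    by (auto simp: mat_zero)
qed

lemma matrix_inv_one: "matrix_inv (mat 1 :: complex^'n^'n) = mat 1"
proof -
  have "invertible (mat 1 :: complex^'n^'n)" by (auto simp: invertible_def)
  from invertible_matrix_inv(1) [OF this] show ?thesis by simp
qed

lemma V_rep_y_diff: "V_rep d (pb_y1 - pb_y2) = block (mat 1) 0 0 (- mat 1)"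
proof -
  obtain S a b where d: "d = (S, (a, b))" by (metis prod.exhaust)
  show ?thesis
    unfolding rep_diff [OF is_rep_V_rep] V_rep_gen
    by (simp add: d V_gen_simps matrix_sum_eq_iff diag_nth mat_nth)
qed

lemma V_rep_regular_indecomposable:
  fixes d :: "('k::finite, 'l::finite) datum"
  assumes "d \<in> V_tilde"
  shows "V_rep d \<in> regular_indecomposables"
proof -
  obtain S a b where d: "d = (S, (a, b))" by (metis prod.exhaust)
  have acts: "acts_as (V_rep d) (mat 1) x D \<longleftrightarrow> V_rep d x = D" for x D
    by (simp add: acts_as_def matrix_inv_one)
  have "invertible (mat 1 :: complex^('k + 'l)^('k + 'l))" by (auto simp: invertible_def)
  then have eb: "eigenbasis (V_rep d) (mat 1)"
    unfolding eigenbasis_def acts V_rep_gen unfolding d V_gen_simps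
    by (intro conjI exI) (assumption | rule refl)+
  \<comment> \<open>On the second block \<open>y1\<close> acts by \<open>b $ j - 1\<close>, so the
    shifted vector witnesses regularity.\<close>
  have ab: "(a, \<chi> j. b $ j - 1) \<in> reg"
    using assms by (auto simp: d V_tilde_def reg_def)
  have "regular_eigenvalues (V_rep d)"
    unfolding regular_eigenvalues_def
  proof (rule exI [of _ "mat 1"], intro conjI bexI [OF _ ab])
    show "case (a, \<chi> j. b $ j - 1) of (a, b) \<Rightarrow> acts_as (V_rep d) (mat 1) pb_y1 (diag (vjoin a b))"
      by (simp add: acts V_rep_gen) (simp add: d V_gen_simps)
  qed (simp_all add: eb acts V_rep_y_diff)
  then show ?thesis
    using eb indecomposable_V_rep [OF assms] is_rep_V_rep [of d]
    unfolding regular_indecomposables_def calibrated_def by blast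
qed

section \<open>The +1-eigenspace of \<open>y1 - y2\<close>\<close>

lemma matrix_vector_mult_sum_nth:
  fixes X :: "complex^('k::finite + 'l::finite)^('k + 'l)"
  shows "(X *v v) $ p = (\<Sum>i\<in>UNIV. X $ p $ Inl i * v $ Inl i) + (\<Sum>j\<in>UNIV. X $ p $ Inr j * v $ Inr j)"
  by (simp add: matrix_vector_mult_def sum_UNIV_Plus)

lemma y_diff_eigenspace:
  fixes v :: "complex^('k::finite + 'l::finite)"
  shows "block (mat 1) 0 0 (- mat 1) *v v = v \<longleftrightarrow> (\<forall>j. v $ Inr j = 0)"
proof -
  have D: "block (mat 1) 0 0 (- mat 1) = (diag (vjoin 1 (- 1)) :: complex^('k + 'l)^('k + 'l))"
    by (simp add: matrix_sum_eq_iff diag_nth mat_nth)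
  have diag_v: "(diag u *v v) $ p = u $ p * v $ p" for u :: "complex^('k + 'l)" and p
    by (simp add: matrix_vector_mult_def diag_nth if_distrib [where f = "\<lambda>x. x * _"] cong: if_cong)
  have "block (mat 1) 0 0 (- mat 1) *v v = v \<longleftrightarrow> (\<forall>p. vjoin 1 (- 1) $ p * v $ p = v $ p)"
    unfolding D vec_eq_iff diag_v by (rule refl)
  also have "\<dots> \<longleftrightarrow> (\<forall>j. v $ Inr j = 0)"
    by (auto simp: split_sum_all)
  finally show ?thesis .
qed

text \<open>The +1-eigenspace is the span of the first block of basis vectors. All four generators
  are block upper triangular, so it is invariant.\<close>

lemma V_rep_not_hecke_exceptional: "V_rep d \<notin> hecke_exceptional"
proof -
  obtain S a b where d: "d = (S, (a, b))" by (metis prod.exhaust)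
  have lower: "V_gen d g $ Inr j $ Inl i = 0" for g i j
    by (cases g) (simp_all add: d V_gen_simps diag_nth)
  have "subrep (V_rep d) {v. V_rep d (pb_y1 - pb_y2) *v v = v}"
    unfolding V_rep_y_diff y_diff_eigenspace
    by (rule subrepI)
       (auto simp: is_rep_V_rep V_rep_gen vec.subspace_def matrix_vector_mult_sum_nth lower)
  then show ?thesis by (simp add: hecke_exceptional_def)
qed

text \<open>Everything but the off-diagonal blocks \<open>B\<close>, \<open>C\<close> of \<open>s\<close> is forced. Since \<open>C\<close> may be nonzero
  only where \<open>a\<^sub>j = \<beta>\<^sub>i + 1\<close>, regularity leaves at most one nonzero entry in each of its rows
  and columns.\<close>

lemma relations_normal_form:
  fixes M :: "pb_gen \<Rightarrow> complex^('k::finite + 'l::finite)^('k + 'l)"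
  assumes rels: "satisfies_relations M"
    and y1: "M GY1 = diag (vjoin a \<beta>)"
    and y_diff: "M GY1 - M GY2 = block (mat 1) 0 0 (- mat 1)"
  obtains B C where "M GS = block (- mat 1) B C (mat 1)"
    and "M GY2 = diag (vjoin (\<chi> i. a $ i - 1) (\<chi> j. \<beta> $ j + 1))"
    and "M GE = block 0 (\<chi> i j. (a $ i - (\<beta> $ j + 1)) * B $ i $ j) 0 0"
    and "B ** C = 0" "C ** B = 0" "\<And>i j. C $ i $ j \<noteq> 0 \<Longrightarrow> a $ j = \<beta> $ i + 1"
proof -
  let ?D = "block (mat 1) 0 0 (- mat 1) :: complex^('k + 'l)^('k + 'l)"
  obtain A B C D where s: "M GS = block A B C D" by (rule block_exhaust)
  obtain E1 E2 E3 E4 where e: "M GE = block E1 E2 E3 E4" by (rule block_exhaust)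
  have "M GY2 = M GY1 - ?D"
    using y_diff by (simp add: algebra_simps)
  then have y2: "M GY2 = diag (vjoin (\<chi> i. a $ i - 1) (\<chi> j. \<beta> $ j + 1))"
    by (simp add: y1 matrix_sum_eq_iff diag_nth mat_nth)
  have ss: "M GS ** M GS = mat 1"
    and sy1: "M GS ** M GY1 = M GY2 ** M GS - mat 1 - M GE"
    and sy2: "M GS ** M GY2 = M GY1 ** M GS + mat 1 - M GE"
    and ey: "M GE ** M GY2 = M GE ** M GY1 + M GE"
    and ye: "M GY1 ** M GE = M GY2 ** M GE + M GE"
    using rels by (auto simp: satisfies_relations_iff Let_def)
  \<comment> \<open>The relation \<open>ye\<close> says that \<open>y1 - y2 - 1\<close> kills
    \<open>e\<close> from the left; on the lower block this factor is -2, so the lower rows of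
    \<open>e\<close> vanish. By \<open>ey\<close>, the factor \<open>y1 - y2 + 1\<close> kills
    \<open>e\<close> from the right; it is 2 on the first block, so \<open>E1\<close> vanishes
    too.\<close>
  have "E3 $ j $ i = 0" "E4 $ j $ j' = 0" for i j j'
    using ye by (simp_all add: y1 y2 e matrix_sum_eq_iff diag_mult_entry mult_diag_entry algebra_simps)
  moreover have "E1 $ i $ i' = 0" for i i'
    using ey by (simp add: y1 y2 e matrix_sum_eq_iff diag_mult_entry mult_diag_entry algebra_simps)
  ultimately have E: "E1 = 0" "E3 = 0" "E4 = 0"
    by (simp_all add: vec_eq_iff)
  have A1: "A $ i $ i' * a $ i' = (a $ i - 1) * A $ i $ i' - (if i = i' then 1 else 0)"
    and A2: "A $ i $ i' * (a $ i' - 1) = a $ i * A $ i $ i' + (if i = i' then 1 else 0)" for i i'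
    using sy1 sy2
    by (simp_all add: y1 y2 e s E matrix_sum_eq_iff diag_mult_entry mult_diag_entry mat_nth)
  have D1: "D $ j $ j' * \<beta> $ j' = (\<beta> $ j + 1) * D $ j $ j' - (if j = j' then 1 else 0)"
    and D2: "D $ j $ j' * (\<beta> $ j' + 1) = \<beta> $ j * D $ j $ j' + (if j = j' then 1 else 0)" for j j'
    using sy1 sy2
    by (simp_all add: y1 y2 e s E matrix_sum_eq_iff diag_mult_entry mult_diag_entry mat_nth)
  have B1: "B $ i $ j * \<beta> $ j = (a $ i - 1) * B $ i $ j - E2 $ i $ j"
    and C1: "C $ j $ i * a $ i = (\<beta> $ j + 1) * C $ j $ i" for i j
    using sy1
    by (simp_all add: y1 y2 e s E matrix_sum_eq_iff diag_mult_entry mult_diag_entry mat_nth)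
  \<comment> \<open>Subtracting \<open>A2\<close> from \<open>A1\<close> cancels the eigenvalues and
    leaves twice the entry of \<open>A\<close> equal to -2 on the diagonal and to 0 off it. The same
    works for \<open>D\<close> with the opposite sign.\<close>
  have "A $ i $ i' = (if i = i' then - 1 else 0)" for i i'
    using A1 [of i i'] A2 [of i i']
    by (cases "i = i'") (simp_all add: algebra_simps eq_neg_iff_add_eq_0)
  then have A: "A = - mat 1" by (simp add: vec_eq_iff mat_nth)
  have "D $ i $ i' = (if i = i' then 1 else 0)" for i i'
    using D1 [of i i'] D2 [of i i']
    by (cases "i = i'") (simp_all add: algebra_simps eq_neg_iff_add_eq_0)
  then have D: "D = mat 1" by (simp add: vec_eq_iff mat_nth)
  have E2: "E2 = (\<chi> i j. (a $ i - (\<beta> $ j + 1)) * B $ i $ j)"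
    using B1 by (simp add: vec_eq_iff algebra_simps)
  have "B ** C = 0" "C ** B = 0"
    using ss by (simp_all add: s A D block_mult mat_block block_eq_iff matrix_mult_uminus)
  moreover have "a $ j = \<beta> $ i + 1" if "C $ i $ j \<noteq> 0" for i j
    using C1 [of i j] that by simp
  ultimately show ?thesis
    using that s e y2 E2 by (simp add: A D E)
qed

text \<open>The cases are \<open>C = 0\<close> and \<open>C \<noteq> 0\<close> in the normal form.
  In the first, indecomposability makes the graph of \<open>B\<close> connected. In the second, a
  nonzero entry of \<open>C\<close> isolates one index from each block, and indecomposability leaves
  nothing else.\<close>

lemma regular_indecomposable_cases:
  fixes \<rho> :: "('k::finite + 'l::finite) pb_rep"
  assumes "\<rho> \<in> regular_indecomposables"
  obtains (V_rep) d :: "('k, 'l) datum" where "d \<in> V_tilde" "rep_iso \<rho> (V_rep d)"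
  | (exceptional) "CARD('k) = 1" "CARD('l) = 1" "\<rho> \<in> hecke_exceptional"
proof -
  have rho: "is_rep \<rho>" "indecomposable \<rho>"
    using assms by (auto simp: regular_indecomposables_def)
  obtain P and a :: "complex^'k" and \<beta> :: "complex^'l" where inv: "invertible P"
    and yd: "acts_as \<rho> P (pb_y1 - pb_y2) (block (mat 1) 0 0 (- mat 1))"
    and y1: "acts_as \<rho> P pb_y1 (diag (vjoin a \<beta>))" and ab: "(a, \<beta>) \<in> reg"
    using assms by (auto simp: regular_indecomposables_def regular_eigenvalues_def eigenbasis_def)
  define \<rho>' where "\<rho>' x = matrix_inv P ** \<rho> x ** P" for x
  have rho': "is_rep \<rho>'" "rep_iso \<rho> \<rho>'"
    using is_rep_conjugate [OF rho(1) inv] by (simp_all add: \<rho>'_def [abs_def])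
  have ind: "indecomposable \<rho>'"
    using indecomposable_rep_iso rho'(2) rho(2) by blast
  have y_diff: "\<rho>' (pb_y1 - pb_y2) = block (mat 1) 0 0 (- mat 1)"
    using yd by (simp add: acts_as_def \<rho>'_def)
  have y1': "\<rho>' pb_y1 = diag (vjoin a \<beta>)"
    using y1 by (simp add: acts_as_def \<rho>'_def)
  obtain B C where s: "\<rho>' pb_s = block (- mat 1) B C (mat 1)"
    and y2': "\<rho>' pb_y2 = diag (vjoin (\<chi> i. a $ i - 1) (\<chi> j. \<beta> $ j + 1))"
    and e: "\<rho>' pb_e = block 0 (\<chi> i j. (a $ i - (\<beta> $ j + 1)) * B $ i $ j) 0 0"
    and BC: "B ** C = 0" and CB: "C ** B = 0"
    and C: "\<And>i j. C $ i $ j \<noteq> 0 \<Longrightarrow> a $ j = \<beta> $ i + 1"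
    using relations_normal_form [OF rep_satisfies_relations [OF rho'(1)] y1'] y_diff
    by (auto simp: rep_diff [OF rho'(1)])
  \<comment> \<open>Only \<open>B\<close> and \<open>C\<close> can join different indices: the
    \<open>y\<close> actions are diagonal, and \<open>e\<close> is supported where \<open>B\<close>
    is.\<close>
  have closed: "K = {} \<or> K = UNIV"
    if B: "\<And>i j. B $ i $ j \<noteq> 0 \<Longrightarrow> Inl i \<in> K \<longleftrightarrow> Inr j \<in> K"
      and C: "\<And>i j. C $ j $ i \<noteq> 0 \<Longrightarrow> Inl i \<in> K \<longleftrightarrow> Inr j \<in> K" for K :: "('k + 'l) set"
  proof (rule indecomposable_closed_index_set [OF rho'(1) ind])
    fix g p q assume "\<rho>' (pb_of g) $ p $ q \<noteq> 0"
    then show "p \<in> K \<longleftrightarrow> q \<in> K"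
      using B C by (cases g; cases p; cases q)
        (auto simp: s e y1' y2' diag_nth mat_nth split: if_splits)
  qed
  show thesis
  proof (cases "C = 0")
    case True
    \<comment> \<open>In \<open>V_gen\<close> the second eigenvalue vector of \<open>y1\<close> is
      \<open>b\<close> lowered by 1, so \<open>b\<close> is recovered by adding 1 to
      \<open>\<beta>\<close>.\<close>
    define d where "d = (B, (a, \<chi> j. \<beta> $ j + 1))"
    have "\<rho>' (pb_of g) = V_gen d g" for g
      by (cases g) (simp_all add: d_def V_gen_simps s e y1' y2' True)
    then have "\<rho>' = V_rep d"
      by (rule V_rep_eqI [OF rho'(1)])
    moreover have "rhizomatic B"
      unfolding rhizomatic_iff_connected using closed True by simp
    then have "d \<in> V_tilde"
      using ab by (auto simp: d_def V_tilde_def reg_def)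
    ultimately show ?thesis using V_rep rho'(2) by blast
  next
    case False
    then obtain i j where ij: "C $ i $ j \<noteq> 0" by (auto simp: vec_eq_iff)
    have a_inj: "a $ m = a $ n \<longleftrightarrow> m = n" for m n
      using ab by (auto simp: reg_def)
    have b_inj: "\<beta> $ m = \<beta> $ n \<longleftrightarrow> m = n" for m n
      using ab by (auto simp: reg_def)
    \<comment> \<open>Each nonzero entry of \<open>C\<close> forces an equation between eigenvalues,
      so two of them in one row, or in one column, would contradict regularity.\<close>
    have row: "n = j" if "C $ i $ n \<noteq> 0" for n
      using C [OF ij] C [OF that] a_inj by metis
    have col: "m = i" if "C $ m $ j \<noteq> 0" for m
      using C [OF ij] C [OF that] b_inj by (metis add_right_cancel)
    \<comment> \<open>Column \<open>j\<close> of \<open>C\<close> has its only nonzero entry in row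
      \<open>i\<close>, so column \<open>j\<close> of \<open>B ** C = 0\<close> is column
      \<open>i\<close> of \<open>B\<close> times that entry. For \<open>Brow\<close>, row
      \<open>i\<close> of \<open>C ** B = 0\<close> is used in the same way.\<close>
    have Bcol: "B $ m $ i = 0" for m
    proof -
      have "(\<Sum>k\<in>UNIV. B $ m $ k * C $ k $ j) = (\<Sum>k\<in>UNIV. if k = i then B $ m $ i * C $ i $ j else 0)"
        using col by (intro sum.cong) auto
      moreover have "(B ** C) $ m $ j = 0" by (simp add: BC)
      ultimately show ?thesis using ij by (simp add: matrix_matrix_mult_def)
    qed
    have Brow: "B $ j $ n = 0" for n
    proof -
      have "(\<Sum>k\<in>UNIV. C $ i $ k * B $ k $ n) = (\<Sum>k\<in>UNIV. if k = j then C $ i $ j * B $ j $ n else 0)"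
        using row by (intro sum.cong) auto
      moreover have "(C ** B) $ i $ n = 0" by (simp add: CB)
      ultimately show ?thesis using ij by (simp add: matrix_matrix_mult_def)
    qed
    \<comment> \<open>No entry of \<open>B\<close> meets the pair, and an entry of \<open>C\<close>
      that meets it is the one joining its two members. The pair is thus closed and must be the
      whole index set.\<close>
    have "{Inl j, Inr i} = {} \<or> {Inl j, Inr i} = (UNIV :: ('k + 'l) set)"
      by (rule closed) (use Bcol Brow row col in auto)
    then have K: "p \<in> {Inl j, Inr i}" for p :: "'k + 'l" by blast
    have k: "x = j" for x using K [of "Inl x"] by simp
    have l: "x = i" for x using K [of "Inr x"] by simp
    have "(UNIV :: 'k set) = {j}" "(UNIV :: 'l set) = {i}"
      using k l by blast+
    then have "CARD('k) = card {j}" "CARD('l) = card {i}" by (simp_all only:)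
    then have card: "CARD('k) = 1" "CARD('l) = 1" by simp_all
    obtain Q where Q: "invertible Q" "\<And>x. Q ** \<rho>' x = \<rho> x ** Q"
      using rep_iso_sym [OF rho'(2)] by (auto simp: rep_iso_def)
    have "B $ m $ n = 0" for m n using Brow k [of m] by simp
    then have "\<rho>' pb_e = 0" by (simp add: e matrix_sum_eq_iff)
    then have "\<rho> pb_e ** Q = 0" by (simp flip: Q(2))
    then have "\<rho> pb_e ** Q ** matrix_inv Q = 0" by simp
    then have e0: "\<rho> pb_e = 0"
      by (simp add: invertible_matrix_inv Q(1) flip: matrix_mul_assoc)
    have "\<not> subrep \<rho> {v. \<rho> (pb_y1 - pb_y2) *v v = v}"
    proof
      assume sub: "subrep \<rho> {v. \<rho> (pb_y1 - pb_y2) *v v = v}"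
      have eig: "\<rho> (pb_y1 - pb_y2) *v (Q *v v) = Q *v v \<longleftrightarrow> (\<forall>m. v $ Inr m = 0)" for v
      proof -
        have "\<rho> (pb_y1 - pb_y2) *v (Q *v v) = Q *v (\<rho>' (pb_y1 - pb_y2) *v v)"
          by (simp add: matrix_vector_mul_assoc Q(2))
        moreover have "Q *v x = Q *v y \<longleftrightarrow> x = y" for x y
          by (metis Q(1) invertible_matrix_inv(2) matrix_vector_mul_assoc matrix_vector_mul_lid)
        ultimately show ?thesis by (simp add: y_diff y_diff_eigenspace)
      qed
      \<comment> \<open>This basis vector lies in the +1-eigenspace, but \<open>s\<close> gives it
        the lower component \<open>C $ i $ j\<close>, which is nonzero.\<close>
      let ?v = "axis (Inl j) 1 :: complex^('k + 'l)"
      have "\<rho> pb_s *v (Q *v ?v) \<in> {v. \<rho> (pb_y1 - pb_y2) *v v = v}"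
        using sub eig [of ?v] by (auto simp: subrep_def axis_def)
      then have "\<rho> (pb_y1 - pb_y2) *v (Q *v (\<rho>' pb_s *v ?v)) = Q *v (\<rho>' pb_s *v ?v)"
        by (simp add: matrix_vector_mul_assoc Q(2))
      then have "(\<rho>' pb_s *v ?v) $ Inr i = 0" using eig by blast
      then show False
        using ij by (simp add: s matrix_vector_mult_sum_nth axis_def if_distrib [where f = "\<lambda>x. _ * x"]
            cong: if_cong)
    qed
    then show ?thesis
      using exceptional card assms e0 by (simp add: hecke_exceptional_def)
  qed
qed

section \<open>From orbits to isomorphism classes\<close>

lemma iso_rel_Image_eq:
  assumes "rep_iso \<rho> \<rho>'" "\<rho> \<in> regular_indecomposables" "\<rho>' \<in> regular_indecomposables"
  shows "iso_rel `` {\<rho>} = iso_rel `` {\<rho>'}"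
proof -
  have "rep_iso \<rho> x \<longleftrightarrow> rep_iso \<rho>' x" for x
    using rep_iso_trans [OF assms(1), of x] rep_iso_trans [OF rep_iso_sym [OF assms(1)], of x] by blast
  then show ?thesis using assms(2,3) by (simp add: iso_rel_def)
qed

text \<open>Members of one orbit are isomorphic, so the union defining \<open>orbit_class\<close>
  collapses to a single class; this is well-definedness of the map.\<close>

lemma orbit_class_orbit:
  assumes "d \<in> V_tilde"
  shows "orbit_class (orbit d) = iso_rel `` {V_rep d}"
proof
  show "orbit_class (orbit d) \<subseteq> iso_rel `` {V_rep d}"
  proof
    fix \<rho> assume "\<rho> \<in> orbit_class (orbit d)"
    then obtain d' where d': "d' \<in> orbit d" "(V_rep d', \<rho>) \<in> iso_rel"
      unfolding orbit_class_def by blast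
    then have "rep_iso (V_rep d) \<rho>"
      using rep_iso_trans [OF rep_iso_if_orbit [OF d'(1)], of \<rho>] by (simp add: iso_rel_def)
    then show "\<rho> \<in> iso_rel `` {V_rep d}"
      using V_rep_regular_indecomposable [OF assms] d'(2) by (simp add: iso_rel_def)
  qed
  show "iso_rel `` {V_rep d} \<subseteq> orbit_class (orbit d)"
    using orbit_self [OF assms] unfolding orbit_class_def by blast
qed

text \<open>The set \<open>R\<close> is kept general to cover both bijections of the theorem.
  Injectivity is \<open>orbit_eq_if_rep_iso\<close>; surjectivity is the hypothesis
  \<open>complete\<close>.\<close>

lemma bij_betw_orbit_class:
  fixes R :: "('k::finite + 'l::finite) pb_rep set"
  assumes "R \<subseteq> regular_indecomposables"
    and "\<And>d :: ('k, 'l) datum. d \<in> V_tilde \<Longrightarrow> V_rep d \<in> R"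
    and complete: "\<And>\<rho>. \<rho> \<in> R \<Longrightarrow> \<exists>d :: ('k, 'l) datum. d \<in> V_tilde \<and> rep_iso \<rho> (V_rep d)"
  shows "bij_betw orbit_class (orbit_space :: ('k, 'l) datum set set) (R // iso_rel)"
  unfolding bij_betw_def
proof
  show "inj_on orbit_class (orbit_space :: ('k, 'l) datum set set)"
  proof (rule inj_onI)
    fix Q Q' :: "('k, 'l) datum set"
    assume Q: "Q \<in> orbit_space" "Q' \<in> orbit_space" and eq: "orbit_class Q = orbit_class Q'"
    obtain d d' where d: "d \<in> V_tilde" "d' \<in> V_tilde" "Q = orbit d" "Q' = orbit d'"
      using Q by (auto simp: orbit_space_def)
    have "V_rep d' \<in> iso_rel `` {V_rep d'}"
      using V_rep_regular_indecomposable [OF d(2)] by (simp add: iso_rel_def rep_iso_refl)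
    then have "V_rep d' \<in> iso_rel `` {V_rep d}"
      using eq by (simp add: d orbit_class_orbit)
    then have "rep_iso (V_rep d) (V_rep d')"
      by (simp add: iso_rel_def)
    then show "Q = Q'" using d orbit_eq_if_rep_iso by blast
  qed
  have "iso_rel `` {\<rho>} \<in> orbit_class ` (orbit_space :: ('k, 'l) datum set set)" if R: "\<rho> \<in> R" for \<rho>
  proof -
    obtain d :: "('k, 'l) datum" where "d \<in> V_tilde" "rep_iso \<rho> (V_rep d)"
      using complete [OF R] by blast
    then have "iso_rel `` {\<rho>} = orbit_class (orbit d)"
      using iso_rel_Image_eq R assms(1) V_rep_regular_indecomposable orbit_class_orbit by blast
    then show ?thesis using \<open>d \<in> V_tilde\<close> by (auto simp: orbit_space_def)
  qed
  then have "R // iso_rel \<subseteq> orbit_class ` (orbit_space :: ('k, 'l) datum set set)"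
    unfolding quotient_def by blast
  moreover have "orbit_class (orbit d) \<in> R // iso_rel"
    if "d \<in> V_tilde" for d :: "('k, 'l) datum"
    unfolding orbit_class_orbit [OF that] by (rule quotientI) (rule assms(2) [OF that])
  then have "orbit_class ` (orbit_space :: ('k, 'l) datum set set) \<subseteq> R // iso_rel"
    unfolding orbit_space_def by blast
  ultimately show "orbit_class ` (orbit_space :: ('k, 'l) datum set set) = R // iso_rel"
    by blast
qed

theorem theorem21:
  shows
    "(\<forall>d1 \<in> (V_tilde :: ('k::finite, 'l::finite) datum set). \<forall>d2 \<in> V_tilde.
        V_rep d1 \<in> regular_indecomposables \<longrightarrow> V_rep d2 \<in> regular_indecomposables \<longrightarrow>
        (rep_iso (V_rep d1) (V_rep d2) \<longleftrightarrow> (\<exists>Q \<in> orbit_space. d1 \<in> Q \<and> d2 \<in> Q)))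
   \<and> (CARD('k) \<ge> 2 \<or> CARD('l) \<ge> 2 \<longrightarrow>
        bij_betw orbit_class (orbit_space :: ('k, 'l) datum set set)
          (regular_indecomposables // iso_rel))
   \<and> bij_betw orbit_class (orbit_space :: ('k, 'l) datum set set)
        ((regular_indecomposables - hecke_exceptional) // iso_rel)"
proof (intro conjI ballI impI)
  fix d1 d2 :: "('k, 'l) datum"
  assume d: "d1 \<in> V_tilde" "d2 \<in> V_tilde"
  show "rep_iso (V_rep d1) (V_rep d2) \<longleftrightarrow> (\<exists>Q \<in> orbit_space. d1 \<in> Q \<and> d2 \<in> Q)"
  proof
    assume "rep_iso (V_rep d1) (V_rep d2)"
    then have "d2 \<in> orbit d1"
      using d orbit_eq_if_rep_iso orbit_self by blast
    then show "\<exists>Q \<in> orbit_space. d1 \<in> Q \<and> d2 \<in> Q"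
      using d orbit_self unfolding orbit_space_def by blast
  next
    assume "\<exists>Q \<in> orbit_space. d1 \<in> Q \<and> d2 \<in> Q"
    then obtain d :: "('k, 'l) datum" where "d1 \<in> orbit d" "d2 \<in> orbit d"
      by (auto simp: orbit_space_def)
    then show "rep_iso (V_rep d1) (V_rep d2)"
      using rep_iso_if_orbit rep_iso_sym rep_iso_trans by blast
  qed
next
  assume "CARD('k) \<ge> 2 \<or> CARD('l) \<ge> 2"
  \<comment> \<open>The exceptional alternative would make both cardinalities 1, so every regular
    indecomposable is isomorphic to some \<open>V_rep d\<close>.\<close>
  then show "bij_betw orbit_class (orbit_space :: ('k, 'l) datum set set)
      (regular_indecomposables // iso_rel)"
    by (intro bij_betw_orbit_class)
       (auto intro: V_rep_regular_indecomposable elim!: regular_indecomposable_cases)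
next
  \<comment> \<open>The exceptional alternative is now excluded by the choice of \<open>R\<close>,
    and each \<open>V_rep d\<close> remains in \<open>R\<close> by
    \<open>V_rep_not_hecke_exceptional\<close>.\<close>
  show "bij_betw orbit_class (orbit_space :: ('k, 'l) datum set set)
      ((regular_indecomposables - hecke_exceptional) // iso_rel)"
    by (intro bij_betw_orbit_class)
       (auto intro: V_rep_regular_indecomposable V_rep_not_hecke_exceptional [THEN notE]
         elim!: regular_indecomposable_cases)
qed

end
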